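(* For each $n$ let $(X_i,y_i)$, $i=1,\dots,n$, be i.i.d. with $X_i\sim\mathcal N_p(0,\Sigma)$, $p=p(n)$, and $y_i=F(\beta^\top X_i,U_i)\in\mathcal Y$, where $\beta\in\mathbb R^p$ is deterministic, $F$ is a deterministic function and $U_i$ is a random variable independent of $X_i$. Suppose $\beta^\top\Sigma\beta=1$ and $0<c_\Sigma^{-1}\le\lambda_{\min}(\Sigma)\le\lambda_{\max}(\Sigma)\le c_\Sigma<\infty$ for a constant $c_\Sigma$. Let $\bar\ell:\mathbb R\times\mathcal Y\to\mathbb R$ be an arbitrary loss function and let $$\bar\beta\in\arg\min_{b\in\mathbb R^p}\sum_{i=1}^n\bar\ell(b^\top X_i;y_i).$$ Suppose that $\bar\beta$ is uniquely determined and that there is a constant $C>0$ such that $\mathbb P(\|\bar\beta\|<C)\ge1-o(1)$. Define $$\mu_{\bar\beta}=\frac{\bar\beta^\top\Sigma\beta}{\beta^\top\Sigma\beta},\qquad \sigma_{\bar\beta}^2=\|P^\perp_{\Sigma^{1/2}\beta}\Sigma^{1/2}\bar\beta\|^2=\|\bar\beta-\mu_{\bar\beta}\beta\|_\Sigma^2,$$ where $P^\perp_{\Sigma^{1/2}\beta}=I_p-\Sigma^{1/2}\beta\beta^\top\Sigma^{1/2}/(\beta^\top\Sigma\beta)$. Then, for any coordinate $j\in\{1,\dots,p\}$ with $\sqrt p\,\tau_j\beta_j=O(1)$, $$T_j:=\frac{\sqrt p\,(\bar\beta_j-\mu_{\bar\beta}\beta_j)}{\sigma_{\bar\beta}/\tau_j}\overset{d}{\to}\mathcal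 N(0,1)$$ as $n,p\to\infty$ with $p/n\to\bar\kappa<1$.
   Context: $\|b\|_\Sigma^2:=b^\top\Sigma b$. $\tau_j>0$ is defined by $\tau_j^2=1/(\Sigma^{-1})_{jj}$. $\mathcal Y\subset\mathbb R$ is the set of possible responses. $\bar\kappa$ is a positive constant. The objects $\beta,\Sigma,\bar\beta$ depend on $n$; the constants $c_\Sigma,C$ do not.
   Formalization: Added so that T_j is defined: P(σ_β̄ ≠ 0) → 1 (the loss u² gives β̄ = 0, T_j = 0/0). Also β̄ is a Borel function of the data, unique for almost every sample under its law (else a non-measurable loss can break the claim), F is Borel and U_i is real. *)

theory Defs
  imports
    "HOL-Probability.Probability"
    "HOL-Library.Landau_Symbols"
    "Jordan_Normal_Form.Spectral_Radius"
    "Jordan_Normal_Form.Gauss_Jordan_Elimination"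
begin

unbundle no inner_syntax
unbundle no vec_syntax

hide_type (open) Finite_Cartesian_Product.vec
hide_const (open) Finite_Cartesian_Product.vec

text \<open>
  The dimension varies with the sample size, so vectors and matrices are those of
  \<^theory>\<open>Jordan_Normal_Form.Matrix\<close>, with coordinates numbered from \<open>0\<close> to \<open>d - 1\<close>.
\<close>

definition vec_norm2 :: "real vec \<Rightarrow> real" where
  "vec_norm2 v = sqrt (v \<bullet> v)"

text \<open>The Borel sigma-algebra of \<open>d\<close>-dimensional space, as generated by the coordinates.\<close>

definition borel_vec :: "nat \<Rightarrow> real vec measure" where
  "borel_vec d =
     vimage_algebra (carrier_vec d) (\<lambda>v. \<lambda>k\<in>{..<d}. v $ k) (\<Pi>\<^sub>M k\<in>{..<d}. borel)"

lemma space_borel_vec [simp]: "space (borel_vec d) = carrier_vec d"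
  by (simp add: borel_vec_def)

lemma measurable_borel_vec_iff:
  "f \<in> measurable M (borel_vec d) \<longleftrightarrow>
     f \<in> space M \<rightarrow> carrier_vec d \<and> (\<forall>k<d. (\<lambda>w. f w $ k) \<in> borel_measurable M)"
  (is "?L \<longleftrightarrow> ?R")
proof
  assume L: ?L
  have f: "f \<in> space M \<rightarrow> carrier_vec d"
    using measurable_space[OF L] by auto
  have "(\<lambda>v. \<lambda>k\<in>{..<d}. v $ k) \<in> measurable (borel_vec d) (\<Pi>\<^sub>M k\<in>{..<d}. (borel :: real measure))"
    unfolding borel_vec_def by (rule measurable_vimage_algebra1) (auto simp: space_PiM)
  from measurable_compose[OF L this]
  have *: "(\<lambda>w. \<lambda>k\<in>{..<d}. f w $ k) \<in> measurable M (\<Pi>\<^sub>M k\<in>{..<d}. (borel :: real measure))" .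
  have "(\<lambda>w. f w $ k) \<in> borel_measurable M" if "k < d" for k
    using measurable_compose[OF * measurable_component_singleton[of k]] that by simp
  with f show ?R by blast
next
  assume R: ?R
  have "(\<lambda>w. \<lambda>k\<in>{..<d}. f w $ k) \<in> measurable M (\<Pi>\<^sub>M k\<in>{..<d}. (borel :: real measure))"
    by (rule measurable_restrict) (use R in auto)
  then show ?L
    unfolding borel_vec_def by (rule measurable_vimage_algebra2[rotated]) (use R in auto)
qed

text \<open>
  The law \<open>N\<close> is centered normal with covariance \<open>S\<close> if it is the image of the standard
  normal law under a matrix \<open>A\<close> with \<open>A A\<^sup>T = S\<close>; the law does not depend on the choice of \<open>A\<close>.
\<close>

definition std_normal_vec :: "nat \<Rightarrow> real vec measure" where
  "std_normal_vec d =
     distr (\<Pi>\<^sub>M k\<in>{..<d}. std_normal_distribution) (borel_vec d) (\<lambda>z. vec d z)"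

definition centered_normal_law :: "nat \<Rightarrow> real mat \<Rightarrow> real vec measure \<Rightarrow> bool" where
  "centered_normal_law d S N \<longleftrightarrow>
     (\<exists>A \<in> carrier_mat d d. A * transpose_mat A = S \<and>
        N = distr (std_normal_vec d) (borel_vec d) (\<lambda>z. A *\<^sub>v z))"

text \<open>
  Unlike \<^const>\<open>prob_space.indep_var\<close>, this allows the two variables to have different types.
\<close>

definition indep_pair ::
    "'w measure \<Rightarrow> 'a measure \<Rightarrow> ('w \<Rightarrow> 'a) \<Rightarrow> 'b measure \<Rightarrow> ('w \<Rightarrow> 'b) \<Rightarrow> bool" where
  "indep_pair M N X K Z \<longleftrightarrow>
     X \<in> measurable M N \<and> Z \<in> measurable M K \<and>
     prob_space.indep_set M {X -` A \<inter> space M |A. A \<in> sets N} {Z -` B \<inter> space M |B. B \<in> sets K}"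

text \<open>
  A sample of size \<open>n\<close> is a family of pairs (covariate, response) indexed by \<open>{1..n}\<close>, with
  responses in \<open>Y\<close>; the set \<open>Y\<close> carries the trace of the Borel sigma-algebra.
\<close>

type_synonym sample = "nat \<Rightarrow> real vec \<times> real"

definition obs_space :: "nat \<Rightarrow> real set \<Rightarrow> (real vec \<times> real) measure" where
  "obs_space d Y = borel_vec d \<Otimes>\<^sub>M restrict_space borel Y"

definition sample_space :: "nat \<Rightarrow> nat \<Rightarrow> real set \<Rightarrow> sample measure" where
  "sample_space n d Y = (\<Pi>\<^sub>M i\<in>{1..n}. obs_space d Y)"

definition total_loss :: "(real \<Rightarrow> real \<Rightarrow> real) \<Rightarrow> nat \<Rightarrow> sample \<Rightarrow> real vec \<Rightarrow> real" where
  "total_loss l n D b = (\<Sum>i=1..n. l (b \<bullet> fst (D i)) (snd (D i)))"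

definition norm_wrt :: "real mat \<Rightarrow> real vec \<Rightarrow> real" where
  "norm_wrt S b = sqrt (b \<bullet> (S *\<^sub>v b))"

definition mu_coef :: "real mat \<Rightarrow> real vec \<Rightarrow> real vec \<Rightarrow> real" where
  "mu_coef S \<beta> b = (b \<bullet> (S *\<^sub>v \<beta>)) / (\<beta> \<bullet> (S *\<^sub>v \<beta>))"

definition sigma_coef :: "real mat \<Rightarrow> real vec \<Rightarrow> real vec \<Rightarrow> real" where
  "sigma_coef S \<beta> b = norm_wrt S (b - mu_coef S \<beta> b \<cdot>\<^sub>v \<beta>)"

definition tau_coef :: "real mat \<Rightarrow> nat \<Rightarrow> real" where
  "tau_coef S j = sqrt (1 / the (mat_inverse S) $$ (j, j))"

definition T_stat :: "real mat \<Rightarrow> real vec \<Rightarrow> real vec \<Rightarrow> nat \<Rightarrow> real" where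
  "T_stat S \<beta> b j =
     sqrt (real (dim_vec \<beta>)) * (b $ j - mu_coef S \<beta> b * \<beta> $ j)
       / (sigma_coef S \<beta> b / tau_coef S j)"

text \<open>
  The other form of the scale, via the projection onto the orthogonal complement of
  \<open>R \<beta>\<close>, where \<open>R\<close> is a symmetric square root of \<open>S\<close>.
\<close>

definition proj_perp :: "real vec \<Rightarrow> real mat" where
  "proj_perp v = 1\<^sub>m (dim_vec v) - (1 / (v \<bullet> v)) \<cdot>\<^sub>m mat (dim_vec v) (dim_vec v) (\<lambda>(i, k). v $ i * v $ k)"

lemma proj_perp_mult_vec:
  assumes v: "v \<in> carrier_vec d" and w: "w \<in> carrier_vec d"
  shows "proj_perp v *\<^sub>v w = w - ((v \<bullet> w) / (v \<bullet> v)) \<cdot>\<^sub>v v"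
proof (rule eq_vecI)
  fix i assume "i < dim_vec (w - ((v \<bullet> w) / (v \<bullet> v)) \<cdot>\<^sub>v v)"
  then have i: "i < d" using v by simp
  have "(proj_perp v *\<^sub>v w) $ i =
      (\<Sum>k<d. ((if i = k then 1 else 0) - (1 / (v \<bullet> v)) * (v $ i * v $ k)) * w $ k)"
    using v w i by (simp add: proj_perp_def scalar_prod_def atLeast0LessThan)
  also have "\<dots> = (\<Sum>k<d. (if i = k then w $ k else 0)) - (\<Sum>k<d. v $ i / (v \<bullet> v) * (v $ k * w $ k))"
    unfolding sum_subtractf[symmetric] by (rule sum.cong) (auto simp: algebra_simps)
  also have "\<dots> = w $ i - v $ i / (v \<bullet> v) * (v \<bullet> w)"
    using v w i by (simp add: scalar_prod_def[of v w] atLeast0LessThan sum_distrib_left)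
  finally show "(proj_perp v *\<^sub>v w) $ i = (w - ((v \<bullet> w) / (v \<bullet> v)) \<cdot>\<^sub>v v) $ i"
    using v w i by simp
qed (use v w in \<open>simp add: proj_perp_def\<close>)

lemma sigma_coef_eq_projection:
  assumes R: "R \<in> carrier_mat d d" and sym: "transpose_mat R = R" and sq: "R * R = S"
    and \<beta>: "\<beta> \<in> carrier_vec d" and b: "b \<in> carrier_vec d"
  shows "sigma_coef S \<beta> b = vec_norm2 (proj_perp (R *\<^sub>v \<beta>) *\<^sub>v (R *\<^sub>v b))"
proof -
  have form: "x \<bullet> (S *\<^sub>v y) = (R *\<^sub>v x) \<bullet> (R *\<^sub>v y)"
    if x: "x \<in> carrier_vec d" and y: "y \<in> carrier_vec d" for x y
  proof -
    have "S *\<^sub>v y = R *\<^sub>v (R *\<^sub>v y)"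
      using R y by (simp add: sq[symmetric])
    moreover have "x \<bullet> (R *\<^sub>v (R *\<^sub>v y)) = (transpose_mat R *\<^sub>v x) \<bullet> (R *\<^sub>v y)"
      using transpose_vec_mult_scalar[OF R, of "R *\<^sub>v y" x] R x y by simp
    ultimately show ?thesis by (simp add: sym)
  qed
  have mu: "mu_coef S \<beta> b = ((R *\<^sub>v \<beta>) \<bullet> (R *\<^sub>v b)) / ((R *\<^sub>v \<beta>) \<bullet> (R *\<^sub>v \<beta>))"
    using R b \<beta> by (simp add: mu_coef_def form comm_scalar_prod[of _ d])
  have "R *\<^sub>v (b - mu_coef S \<beta> b \<cdot>\<^sub>v \<beta>) = R *\<^sub>v b - mu_coef S \<beta> b \<cdot>\<^sub>v (R *\<^sub>v \<beta>)"
    using R b \<beta>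
    by (subst mult_minus_distrib_mat_vec[OF R])
       (simp_all add: mult_mat_vec[OF R])
  then have "R *\<^sub>v (b - mu_coef S \<beta> b \<cdot>\<^sub>v \<beta>) = proj_perp (R *\<^sub>v \<beta>) *\<^sub>v (R *\<^sub>v b)"
    using R b \<beta> by (simp add: proj_perp_mult_vec[of _ d] mu)
  then show ?thesis
    using b \<beta> by (simp add: sigma_coef_def norm_wrt_def vec_norm2_def form)
qed

end

theory Submission
  imports Defs "HOL-Real_Asymp.Real_Asymp"
begin

text \<open>
  Write \<open>\<Sigma> = A A\<^sup>T\<close>, so that \<open>X\<^sub>i = A g\<^sub>i\<close> with \<open>g\<^sub>i\<close> standard normal, and put
  \<open>\<theta> = A\<^sup>T \<beta>\<close>, a unit vector. A reflection of \<open>g\<^sub>i\<close> that fixes \<open>\<theta>\<close> does not change the law of the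
  sample, and it reflects \<open>A\<^sup>T b\<close> for the unique minimizer \<open>b\<close>; hence the law of the residual
  \<open>v = A\<^sup>T (b - \<mu> \<beta>)\<close>, which is orthogonal to \<open>\<theta>\<close>, is invariant under all these reflections.
  Now \<open>T\<^sub>j\<close> is the component along \<open>v / |v|\<close> of a vector orthogonal to \<open>\<theta>\<close> whose squared length is
  \<open>p - p \<tau>\<^sub>j\<^sup>2 \<beta>\<^sub>j\<^sup>2 = p + O(1)\<close>, and by invariance the law of such a component depends only on
  that length. So the vector may be replaced by the projection of an independent standard normal
  vector, whose length is also close to the square root of \<open>p\<close> but whose component along \<open>v / |v|\<close>
  is standard normal. No Haar measure on the sphere is needed, and comparing the two lengths bounds the
  difference of the characteristic functions explicitly.
\<close>

text \<open>The obstacle is that nothing can be computed about the minimizer: the loss is arbitrary,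
  so only symmetries of the data are usable. Reflections are enough because two vectors of equal
  length are exchanged by the reflection in their difference, and this one fixes \<theta> when both
  vectors are orthogonal to it. The independent normal vector serves twice. Averaging squares shows
  that a unit component of \<open>v / |v|\<close> has second moment at most
  \<open>1 / (p - 1)\<close>. Averaging exponentials gives the normal characteristic function up to
  the probability of \<open>v = 0\<close>. The two lengths differ on average by a bounded amount
  that does not vanish; the missing factor of order \<open>1 / sqrt p\<close> comes from the second
  moment, which controls the Lipschitz constant of the characteristic function of a unit component.
  The result is a bound for each fixed sample size, and the limit is taken only at the end.\<close>

section \<open>Measurability of operations on vectors\<close>

lemma measurable_vec [measurable]:
  "vec d \<in> measurable (\<Pi>\<^sub>M k\<in>{..<d}. (borel :: real measure)) (borel_vec d)"
  unfolding measurable_borel_vec_iff by (auto intro!: measurable_component_singleton)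

lemma measurable_vec_index [measurable (raw)]:
  "f \<in> measurable M (borel_vec d) \<Longrightarrow> k < d \<Longrightarrow> (\<lambda>w. f w $ k) \<in> borel_measurable M"
  by (simp add: measurable_borel_vec_iff)

lemma measurable_borel_vec_carrier:
  "f \<in> measurable M (borel_vec d) \<Longrightarrow> w \<in> space M \<Longrightarrow> f w \<in> carrier_vec d"
  by (auto simp: measurable_borel_vec_iff)

lemma borel_vec_measurable_add [measurable (raw)]:
  "f \<in> measurable M (borel_vec d) \<Longrightarrow> g \<in> measurable M (borel_vec d) \<Longrightarrow>
    (\<lambda>w. f w + g w) \<in> measurable M (borel_vec d)"
  by (subst measurable_borel_vec_iff, safe)
     (simp_all add: measurable_borel_vec_carrier carrier_vecD[OF measurable_borel_vec_carrier]
       measurable_vec_index cong: measurable_cong)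

lemma borel_vec_measurable_diff [measurable (raw)]:
  "f \<in> measurable M (borel_vec d) \<Longrightarrow> g \<in> measurable M (borel_vec d) \<Longrightarrow>
    (\<lambda>w. f w - g w) \<in> measurable M (borel_vec d)"
  by (subst measurable_borel_vec_iff, safe)
     (simp_all add: measurable_borel_vec_carrier carrier_vecD[OF measurable_borel_vec_carrier]
       measurable_vec_index cong: measurable_cong)

lemma borel_vec_measurable_smult [measurable (raw)]:
  "c \<in> borel_measurable M \<Longrightarrow> f \<in> measurable M (borel_vec d) \<Longrightarrow>
    (\<lambda>w. c w \<cdot>\<^sub>v f w) \<in> measurable M (borel_vec d)"
  by (subst measurable_borel_vec_iff, safe)
     (simp_all add: measurable_borel_vec_carrier carrier_vecD[OF measurable_borel_vec_carrier]
       measurable_vec_index cong: measurable_cong)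

lemma borel_measurable_scalar_prod:
  assumes "f \<in> measurable M (borel_vec d)" "g \<in> measurable M (borel_vec d)"
  shows "(\<lambda>w. f w \<bullet> g w) \<in> borel_measurable M"
proof -
  have "(\<lambda>w. \<Sum>i<d. f w $ i * g w $ i) \<in> borel_measurable M"
    using assms by (auto intro!: borel_measurable_sum measurable_vec_index borel_measurable_times)
  then show ?thesis
    by (rule measurable_cong[THEN iffD1, rotated])
       (use assms in \<open>simp add: scalar_prod_def carrier_vecD[OF measurable_borel_vec_carrier] atLeast0LessThan\<close>)
qed

lemma borel_vec_measurable_const [measurable]:
  "a \<in> carrier_vec d \<Longrightarrow> (\<lambda>w. a) \<in> measurable M (borel_vec d)"
  by simp

lemma borel_vec_measurable_mult_mat:
  assumes "A \<in> carrier_mat d e" "f \<in> measurable M (borel_vec e)"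
  shows "(\<lambda>w. A *\<^sub>v f w) \<in> measurable M (borel_vec d)"
  unfolding measurable_borel_vec_iff
proof (intro conjI allI impI Pi_I)
  fix k assume k: "k < d"
  have "(\<lambda>w. row A k \<bullet> f w) \<in> borel_measurable M"
    using assms k by (intro borel_measurable_scalar_prod[where d=e] borel_vec_measurable_const row_carrier_vec) auto
  then show "(\<lambda>w. (A *\<^sub>v f w) $ k) \<in> borel_measurable M"
    using assms(1) k by simp
qed (use assms measurable_borel_vec_carrier in \<open>auto intro!: mult_mat_vec_carrier\<close>)

section \<open>The standard normal law\<close>

text \<open>The reference measure for the normal density; the rotation argument takes from it only
  sigma-finiteness and translation invariance.\<close>

definition lborel_vec :: "nat \<Rightarrow> real vec measure" where
  "lborel_vec d = distr (\<Pi>\<^sub>M k\<in>{..<d}. lborel) (borel_vec d) (vec d)"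

lemma sets_PiM_lborel: "sets (\<Pi>\<^sub>M k\<in>I. (lborel :: real measure)) = sets (\<Pi>\<^sub>M k\<in>I. borel)"
  by (intro sets_PiM_cong) auto

lemma measurable_vec_lborel: "vec d \<in> measurable (\<Pi>\<^sub>M k\<in>{..<d}. (lborel :: real measure)) (borel_vec d)"
  using measurable_vec by (simp cong: measurable_cong_sets add: sets_PiM_lborel)

lemma sets_lborel_vec [simp, measurable_cong]: "sets (lborel_vec d) = sets (borel_vec d)"
  and space_lborel_vec [simp]: "space (lborel_vec d) = carrier_vec d"
  by (simp_all add: lborel_vec_def)

text \<open>Sigma-finiteness is pulled back along the coordinate map, whose image measure is product
  Lebesgue measure again: points of the product over \<open>{..<d}\<close> are extensional, so
  passing through \<open>vec d\<close> loses nothing.\<close>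

lemma sigma_finite_lborel_vec: "sigma_finite_measure (lborel_vec d)"
proof -
  interpret L: product_sigma_finite "\<lambda>_ :: nat. lborel :: real measure" by standard
  interpret L: finite_product_sigma_finite "\<lambda>_ :: nat. lborel :: real measure" "{..<d}"
    by standard auto
  let ?P = "\<Pi>\<^sub>M k\<in>{..<d}. (lborel :: real measure)"
  let ?g = "\<lambda>v. \<lambda>k\<in>{..<d}. v $ k"
  have g: "?g \<in> measurable (borel_vec d) ?P"
    by (rule measurable_restrict) (auto intro: measurable_vec_index)
  have "distr (lborel_vec d) ?P ?g = distr ?P ?P (\<lambda>x. ?g (vec d x))"
    unfolding lborel_vec_def by (subst distr_distr[OF g measurable_vec_lborel]) (simp add: comp_def)
  also have "\<dots> = distr ?P ?P (\<lambda>x. x)"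
    by (rule distr_cong) (auto simp: space_PiM PiE_def extensional_def fun_eq_iff)
  finally have "sigma_finite_measure (distr (lborel_vec d) ?P ?g)"
    by (simp add: L.sigma_finite_measure_axioms)
  then show ?thesis
    by (rule sigma_finite_measure_distr) (use g in \<open>simp cong: measurable_cong_sets\<close>)
qed

text \<open>A product measure is determined on boxes, and the preimage of a box is a box with each
  side shifted, so the one-dimensional statement suffices.\<close>

lemma distr_PiM_lborel_translation:
  fixes a :: "'i \<Rightarrow> real"
  assumes "finite I"
  shows "distr (\<Pi>\<^sub>M k\<in>I. lborel) (\<Pi>\<^sub>M k\<in>I. lborel) (\<lambda>x. \<lambda>k\<in>I. x k + a k) = (\<Pi>\<^sub>M k\<in>I. lborel)"
    (is "distr ?P _ ?T = _")
proof -
  interpret product_sigma_finite "\<lambda>_ :: 'i. lborel :: real measure" by standard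
  show ?thesis
  proof (rule PiM_eqI[OF assms])
  have T: "?T \<in> measurable ?P ?P"
    by measurable
  fix E :: "'i \<Rightarrow> real set" assume E: "\<And>i. i \<in> I \<Longrightarrow> E i \<in> sets lborel"
  have E': "(\<lambda>x. x + a i) -` E i \<in> sets borel" if "i \<in> I" for i
    using measurable_sets[of "\<lambda>x. x + a i" borel borel "E i"] E[OF that] by simp
  have "emeasure (distr ?P ?P ?T) (Pi\<^sub>E I E) = emeasure ?P (?T -` Pi\<^sub>E I E \<inter> space ?P)"
    using E assms by (intro emeasure_distr[OF T] sets_PiM_I_finite) auto
  also have "?T -` Pi\<^sub>E I E \<inter> space ?P = (\<Pi>\<^sub>E i\<in>I. (\<lambda>x. x + a i) -` E i)"
    by (auto simp: space_PiM PiE_def Pi_def)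
  also have "emeasure ?P \<dots> = (\<Prod>i\<in>I. emeasure lborel ((\<lambda>x. x + a i) -` E i))"
    using assms E' by (intro emeasure_PiM) auto
  also have "\<dots> = (\<Prod>i\<in>I. emeasure lborel (E i))"
  proof (rule prod.cong[OF refl])
    fix i assume i: "i \<in> I"
    have "emeasure lborel (E i) = emeasure (distr lborel borel ((+) (a i))) (E i)"
      by (simp add: lborel_distr_plus)
    also have "\<dots> = emeasure lborel ((\<lambda>x. x + a i) -` E i)"
      using E[OF i] by (subst emeasure_distr) (auto simp: add.commute vimage_def)
    finally show "emeasure lborel ((\<lambda>x. x + a i) -` E i) = emeasure lborel (E i)" by simp
  qed
  finally show "emeasure (distr ?P ?P ?T) (Pi\<^sub>E I E) = (\<Prod>i\<in>I. emeasure lborel (E i))" .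
  qed simp
qed

lemma measurable_lborel_vec [simp]: "measurable (lborel_vec d) N = measurable (borel_vec d) N"
  by (rule measurable_cong_sets) simp_all

lemma measurable_borel_vec_id: "(\<lambda>x. x) \<in> measurable (borel_vec d) (borel_vec d)"
  by simp

lemma distr_lborel_vec_translation:
  assumes a: "a \<in> carrier_vec d"
  shows "distr (lborel_vec d) (borel_vec d) (\<lambda>x. x + a) = lborel_vec d"
proof -
  let ?P = "\<Pi>\<^sub>M k\<in>{..<d}. (lborel :: real measure)"
  let ?T = "\<lambda>x. \<lambda>k\<in>{..<d}. x k + a $ k"
  have T: "?T \<in> measurable ?P ?P"
    by measurable
  have *: "(\<lambda>x. x + a) \<in> measurable (borel_vec d) (borel_vec d)"
    using a by (intro borel_vec_measurable_add) auto
  have "distr (lborel_vec d) (borel_vec d) (\<lambda>x. x + a) = distr ?P (borel_vec d) (\<lambda>x. vec d x + a)"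
    unfolding lborel_vec_def by (subst distr_distr[OF * measurable_vec_lborel]) (simp add: comp_def)
  also have "\<dots> = distr ?P (borel_vec d) (\<lambda>x. vec d (?T x))"
    using a by (intro distr_cong) auto
  also have "\<dots> = distr (distr ?P ?P ?T) (borel_vec d) (vec d)"
    by (subst distr_distr[OF measurable_vec_lborel T]) (simp add: comp_def)
  also have "\<dots> = lborel_vec d"
    by (simp add: distr_PiM_lborel_translation lborel_vec_def)
  finally show ?thesis .
qed

lemma nn_integral_lborel_vec_translation:
  assumes a: "a \<in> carrier_vec d" and f: "f \<in> borel_measurable (borel_vec d)"
  shows "(\<integral>\<^sup>+x. f (x + a) \<partial>lborel_vec d) = (\<integral>\<^sup>+x. f x \<partial>lborel_vec d)"
proof -
  have *: "(\<lambda>x. x + a) \<in> measurable (lborel_vec d) (borel_vec d)"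
    using a by (intro borel_vec_measurable_add) auto
  show ?thesis
    by (subst (2) distr_lborel_vec_translation[OF a, symmetric]) (use f in \<open>simp add: nn_integral_distr[OF *]\<close>)
qed

lemma PiM_density_lborel:
  fixes f :: "real \<Rightarrow> real"
  assumes I: "finite I" and f [measurable]: "f \<in> borel_measurable borel" and pos: "\<And>x. 0 \<le> f x"
    and prob: "prob_space (density lborel f)"
  shows "(\<Pi>\<^sub>M k\<in>I. density lborel f) = density (\<Pi>\<^sub>M k\<in>I. lborel) (\<lambda>x. \<Prod>k\<in>I. f (x k))"
    (is "_ = density ?P ?f")
proof -
  interpret N: prob_space "density lborel f" by fact
  interpret D: product_sigma_finite "\<lambda>_. density lborel f" by standard
  interpret L: product_sigma_finite "\<lambda>_. lborel :: real measure" by standard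
  have "density ?P ?f = (\<Pi>\<^sub>M k\<in>I. density lborel f)"
  proof (rule D.PiM_eqI[OF I])
    fix A :: "'a \<Rightarrow> real set" assume "\<And>i. i \<in> I \<Longrightarrow> A i \<in> sets (density lborel f)"
    then have A [measurable]: "\<And>i. i \<in> I \<Longrightarrow> A i \<in> sets borel" by simp
    have PA: "Pi\<^sub>E I A \<in> sets ?P"
      using A I by (intro sets_PiM_I_finite) auto
    have "emeasure (density ?P ?f) (Pi\<^sub>E I A) = (\<integral>\<^sup>+x. ?f x * indicator (Pi\<^sub>E I A) x \<partial>?P)"
      using PA by (intro emeasure_density) auto
    also have "\<dots> = (\<integral>\<^sup>+x. (\<Prod>k\<in>I. ennreal (f (x k)) * indicator (A k) (x k)) \<partial>?P)"
    proof (rule nn_integral_cong)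
      fix x assume x: "x \<in> space ?P"
      then have "indicator (Pi\<^sub>E I A) x = (\<Prod>k\<in>I. indicator (A k) (x k) :: ennreal)"
        using I by (auto simp: indicator_def space_PiM PiE_def Pi_def prod_zero_iff)
      then show "?f x * indicator (Pi\<^sub>E I A) x = (\<Prod>k\<in>I. ennreal (f (x k)) * indicator (A k) (x k))"
        by (simp add: prod.distrib prod_ennreal pos)
    qed
    also have "\<dots> = (\<Prod>k\<in>I. \<integral>\<^sup>+x. ennreal (f x) * indicator (A k) x \<partial>lborel)"
      using A I by (intro L.product_nn_integral_prod) auto
    also have "\<dots> = (\<Prod>k\<in>I. emeasure (density lborel f) (A k))"
      using A by (intro prod.cong emeasure_density[symmetric]) auto
    finally show "emeasure (density ?P ?f) (Pi\<^sub>E I A) = (\<Prod>k\<in>I. emeasure (density lborel f) (A k))" .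
  qed (auto intro!: sets_PiM_cong)
  then show ?thesis by simp
qed

section \<open>The normal density and its invariance under isometries\<close>

text \<open>The product of the coordinate densities, written so that \<open>x\<close> enters only
  through \<open>x \<bullet> x\<close>; every isometry therefore preserves it.\<close>

definition std_normal_vec_density :: "nat \<Rightarrow> real vec \<Rightarrow> real" where
  "std_normal_vec_density d x = (1 / sqrt (2 * pi)) ^ d * exp (- (x \<bullet> x) / 2)"

lemma borel_measurable_std_normal_vec_density:
  "std_normal_vec_density d \<in> borel_measurable (borel_vec d)"
proof -
  have [measurable]: "(\<lambda>x. x \<bullet> x) \<in> borel_measurable (borel_vec d)"
    by (rule borel_measurable_scalar_prod[OF measurable_borel_vec_id measurable_borel_vec_id])
  show ?thesis
    unfolding std_normal_vec_density_def by measurable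
qed

lemma std_normal_vec_eq_density:
  "std_normal_vec d = density (lborel_vec d) (std_normal_vec_density d)"
proof -
  let ?P = "\<Pi>\<^sub>M k\<in>{..<d}. (lborel :: real measure)"
  have "std_normal_vec d = distr (density ?P (\<lambda>x. \<Prod>k<d. std_normal_density (x k))) (borel_vec d) (vec d)"
    unfolding std_normal_vec_def
    by (subst PiM_density_lborel) (auto simp: prob_space_normal_density)
  also have "\<dots> = distr (density ?P (\<lambda>x. std_normal_vec_density d (vec d x))) (borel_vec d) (vec d)"
  proof (intro arg_cong[where f="\<lambda>f. distr (density ?P f) _ _"] ext arg_cong[where f=ennreal])
    fix x :: "nat \<Rightarrow> real"
    have "vec d x \<bullet> vec d x = (\<Sum>k<d. (x k)\<^sup>2)"
      by (simp add: scalar_prod_def power2_eq_square atLeast0LessThan)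
    then show "(\<Prod>k<d. std_normal_density (x k)) = std_normal_vec_density d (vec d x)"
      by (simp add: std_normal_vec_density_def std_normal_density_def prod.distrib prod_dividef
          exp_sum[symmetric] sum_negf sum_divide_distrib power_divide prod_power_distrib)
  qed
  also have "\<dots> = density (lborel_vec d) (std_normal_vec_density d)"
    unfolding lborel_vec_def
    by (rule density_distr[symmetric])
       (use borel_measurable_std_normal_vec_density measurable_vec_lborel in auto)
  finally show ?thesis .
qed

lemma prob_space_std_normal_vec: "prob_space (std_normal_vec d)"
proof -
  interpret N: prob_space "std_normal_distribution" by (simp add: prob_space_normal_density)
  have "vec d \<in> measurable (\<Pi>\<^sub>M k\<in>{..<d}. std_normal_distribution) (borel_vec d)"
    using measurable_vec by (rule measurable_cong_sets[THEN equalityD2, THEN subsetD, rotated 2]) (auto intro!: sets_PiM_cong)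
  then show ?thesis
    unfolding std_normal_vec_def by (intro prob_space.prob_space_distr prob_space_PiM N.prob_space_axioms)
qed

lemma sets_std_normal_vec [simp, measurable_cong]: "sets (std_normal_vec d) = sets (borel_vec d)"
  and space_std_normal_vec [simp]: "space (std_normal_vec d) = carrier_vec d"
  by (simp_all add: std_normal_vec_def)

lemma measurable_std_normal_vec [simp]: "measurable (std_normal_vec d) N = measurable (borel_vec d) N"
  by (rule measurable_cong_sets) simp_all

text \<open>
  Uniqueness of Haar measure, in the form needed here: two translations inside a double integral
  against the rotation-invariant normal density replace \<open>Q x\<close> by \<open>x\<close>.
\<close>

lemma nn_integral_lborel_vec_isometry:
  assumes Q: "Q \<in> measurable (borel_vec d) (borel_vec d)"
    and add: "\<And>x y. x \<in> carrier_vec d \<Longrightarrow> y \<in> carrier_vec d \<Longrightarrow> Q (x + y) = Q x + Q y"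
    and inv: "\<And>x. x \<in> carrier_vec d \<Longrightarrow> Q (Q x) = x"
    and iso: "\<And>x. x \<in> carrier_vec d \<Longrightarrow> Q x \<bullet> Q x = x \<bullet> x"
    and F: "F \<in> borel_measurable (borel_vec d)"
  shows "(\<integral>\<^sup>+x. F (Q x) \<partial>lborel_vec d) = (\<integral>\<^sup>+x. F x \<partial>lborel_vec d)"
proof -
  let ?L = "lborel_vec d"
  let ?g = "\<lambda>x. ennreal (std_normal_vec_density d x)"
  interpret L: sigma_finite_measure ?L by (rule sigma_finite_lborel_vec)
  interpret LL: pair_sigma_finite ?L ?L by standard
  interpret N: prob_space "std_normal_vec d" by (rule prob_space_std_normal_vec)
  have g: "?g \<in> borel_measurable (borel_vec d)"
    using borel_measurable_std_normal_vec_density by simp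
  have Qc: "Q x \<in> carrier_vec d" if "x \<in> carrier_vec d" for x
    using measurable_space[OF Q] that by simp
  have one: "(\<integral>\<^sup>+x. ?g x \<partial>?L) = 1"
  proof -
    have "1 = emeasure (density ?L ?g) (space ?L)"
      using N.emeasure_space_1 by (simp add: std_normal_vec_eq_density)
    also have "\<dots> = (\<integral>\<^sup>+x. ?g x * indicator (space ?L) x \<partial>?L)"
      using g sets.top[of ?L] by (intro emeasure_density) auto
    also have "\<dots> = (\<integral>\<^sup>+x. ?g x \<partial>?L)"
      by (intro nn_integral_cong) simp
    finally show ?thesis by simp
  qed
  have QF: "(\<lambda>x. F (Q x)) \<in> borel_measurable (borel_vec d)"
    using measurable_compose[OF Q F] .
  have pr: "fst \<in> measurable (?L \<Otimes>\<^sub>M ?L) (borel_vec d)" "snd \<in> measurable (?L \<Otimes>\<^sub>M ?L) (borel_vec d)"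
    using measurable_fst[of ?L ?L] measurable_snd[of ?L ?L] by (simp_all cong: measurable_cong_sets)
  have Fg: "(\<lambda>(y, x). F (Q x + y) * ?g y) \<in> borel_measurable (?L \<Otimes>\<^sub>M ?L)"
    unfolding split_beta
    by (intro borel_measurable_times_ennreal measurable_compose[OF _ F] measurable_compose[OF _ g]
        borel_vec_measurable_add measurable_compose[OF _ Q] pr)
  have Fg': "(\<lambda>(y, x). F y * ?g (y - Q x)) \<in> borel_measurable (?L \<Otimes>\<^sub>M ?L)"
    unfolding split_beta
    by (intro borel_measurable_times_ennreal measurable_compose[OF _ F] measurable_compose[OF _ g]
        borel_vec_measurable_diff measurable_compose[OF _ Q] pr)
  \<comment> \<open>The total mass \<open>1\<close> of the density is inserted to gain a second
    variable \<open>y\<close>, which makes room for the two translations.\<close>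
  have "(\<integral>\<^sup>+x. F (Q x) \<partial>?L) = (\<integral>\<^sup>+y. ?g y * (\<integral>\<^sup>+x. F (Q x) \<partial>?L) \<partial>?L)"
    using g by (simp add: nn_integral_multc one)
  also have "\<dots> = (\<integral>\<^sup>+y. (\<integral>\<^sup>+x. F (Q x + y) * ?g y \<partial>?L) \<partial>?L)"
  proof (rule nn_integral_cong)
    fix y assume "y \<in> space ?L"
    then have y: "y \<in> carrier_vec d" by simp
    have "(\<integral>\<^sup>+x. F (Q x) \<partial>?L) = (\<integral>\<^sup>+x. F (Q (x + Q y)) \<partial>?L)"
      using nn_integral_lborel_vec_translation[OF Qc[OF y] QF] by simp
    also have "\<dots> = (\<integral>\<^sup>+x. F (Q x + y) \<partial>?L)"
      by (rule nn_integral_cong) (simp add: add inv y Qc)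
    finally show "?g y * (\<integral>\<^sup>+x. F (Q x) \<partial>?L) = (\<integral>\<^sup>+x. F (Q x + y) * ?g y \<partial>?L)"
      using y by (subst nn_integral_multc)
        (auto simp: mult.commute intro!: measurable_compose[OF _ F] borel_vec_measurable_add Q)
  qed
  also have "\<dots> = (\<integral>\<^sup>+x. (\<integral>\<^sup>+y. F (Q x + y) * ?g y \<partial>?L) \<partial>?L)"
    using LL.Fubini[OF Fg] by simp
  also have "\<dots> = (\<integral>\<^sup>+x. (\<integral>\<^sup>+y. F y * ?g (y - Q x) \<partial>?L) \<partial>?L)"
  proof (rule nn_integral_cong)
    fix x assume "x \<in> space ?L"
    then have x: "x \<in> carrier_vec d" by simp
    have "(\<integral>\<^sup>+y. F (Q x + y) * ?g y \<partial>?L) = (\<integral>\<^sup>+y. F ((y + Q x)) * ?g ((y + Q x) - Q x) \<partial>?L)"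
      using Qc[OF x] by (intro nn_integral_cong arg_cong2[where f="(*)"] arg_cong[where f=F] arg_cong[where f="?g"])
        (auto simp: comm_add_vec[of _ d])
    also have "\<dots> = (\<integral>\<^sup>+y. F y * ?g (y - Q x) \<partial>?L)"
      using Qc[OF x] F g
      by (intro nn_integral_lborel_vec_translation[where f="\<lambda>y. F y * ?g (y - Q x)"] borel_measurable_times_ennreal
          measurable_compose[OF _ g] borel_vec_measurable_diff) auto
    finally show "(\<integral>\<^sup>+y. F (Q x + y) * ?g y \<partial>?L) = (\<integral>\<^sup>+y. F y * ?g (y - Q x) \<partial>?L)" .
  qed
  also have "\<dots> = (\<integral>\<^sup>+y. (\<integral>\<^sup>+x. F y * ?g (y - Q x) \<partial>?L) \<partial>?L)"
    using LL.Fubini[OF Fg'] by simp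
  also have "\<dots> = (\<integral>\<^sup>+y. F y \<partial>?L)"
  proof (rule nn_integral_cong)
    fix y assume "y \<in> space ?L"
    then have y: "y \<in> carrier_vec d" by simp
    have m: "(\<lambda>x. ?g (y - Q x)) \<in> borel_measurable (borel_vec d)"
      using y by (intro measurable_compose[OF _ g] borel_vec_measurable_diff Q) auto
    \<comment> \<open>Translating by \<open>Q y\<close> cancels \<open>y\<close>, because
      \<open>Q\<close> is an involution, and leaves \<open>- Q x\<close>, which has the length of
      \<open>x\<close>.\<close>
    have "(\<integral>\<^sup>+x. ?g (y - Q x) \<partial>?L) = (\<integral>\<^sup>+x. ?g (y - Q (x + Q y)) \<partial>?L)"
      using nn_integral_lborel_vec_translation[OF Qc[OF y] m] by simp
    also have "\<dots> = (\<integral>\<^sup>+x. ?g x \<partial>?L)"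
    proof (rule nn_integral_cong)
      fix x assume "x \<in> space ?L"
      then have x: "x \<in> carrier_vec d" by simp
      have "y - Q (x + Q y) = - Q x"
        using Qc[OF x] Qc[OF y] y x by (simp add: add inv) auto
      then have "(y - Q (x + Q y)) \<bullet> (y - Q (x + Q y)) = x \<bullet> x"
        using Qc[OF x] by (simp add: iso[OF x])
      then show "?g (y - Q (x + Q y)) = ?g x"
        by (simp add: std_normal_vec_density_def)
    qed
    finally show "(\<integral>\<^sup>+x. F y * ?g (y - Q x) \<partial>?L) = F y"
      using m by (simp add: nn_integral_cmult one)
  qed
  finally show ?thesis .
qed

text \<open>Passing to densities splits the claim: the density is invariant because it is radial,
  and Lebesgue measure by \<open>nn_integral_lborel_vec_isometry\<close>.\<close>

lemma distr_std_normal_vec_isometry: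
  assumes Q: "Q \<in> measurable (borel_vec d) (borel_vec d)"
    and add: "\<And>x y. x \<in> carrier_vec d \<Longrightarrow> y \<in> carrier_vec d \<Longrightarrow> Q (x + y) = Q x + Q y"
    and inv: "\<And>x. x \<in> carrier_vec d \<Longrightarrow> Q (Q x) = x"
    and iso: "\<And>x. x \<in> carrier_vec d \<Longrightarrow> Q x \<bullet> Q x = x \<bullet> x"
  shows "distr (std_normal_vec d) (borel_vec d) Q = std_normal_vec d"
proof (rule measure_eqI)
  let ?L = "lborel_vec d"
  let ?g = "\<lambda>x. ennreal (std_normal_vec_density d x)"
  have g: "?g \<in> borel_measurable (borel_vec d)"
    using borel_measurable_std_normal_vec_density by simp
  have Q': "Q \<in> measurable (std_normal_vec d) (borel_vec d)"
    using Q by (simp cong: measurable_cong_sets)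
  fix E assume "E \<in> sets (distr (std_normal_vec d) (borel_vec d) Q)"
  then have E: "E \<in> sets (borel_vec d)" by simp
  have "emeasure (distr (std_normal_vec d) (borel_vec d) Q) E = (\<integral>\<^sup>+x. indicator E (Q x) \<partial>std_normal_vec d)"
    using E by (subst nn_integral_distr[OF Q', symmetric]) auto
  also have "\<dots> = (\<integral>\<^sup>+x. ?g x * indicator E (Q x) \<partial>?L)"
    unfolding std_normal_vec_eq_density using g measurable_compose[OF Q borel_measurable_indicator[OF E]]
    by (subst nn_integral_density) auto
  also have "\<dots> = (\<integral>\<^sup>+x. ?g (Q x) * indicator E (Q x) \<partial>?L)"
    by (intro nn_integral_cong) (simp add: std_normal_vec_density_def iso)
  also have "\<dots> = (\<integral>\<^sup>+x. ?g x * indicator E x \<partial>?L)"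
    using E g by (intro nn_integral_lborel_vec_isometry[OF Q add inv iso, where F="\<lambda>x. ?g x * indicator E x"]) auto
  also have "\<dots> = emeasure (std_normal_vec d) E"
    unfolding std_normal_vec_eq_density using g E by (subst emeasure_density) auto
  finally show "emeasure (distr (std_normal_vec d) (borel_vec d) Q) E = emeasure (std_normal_vec d) E" .
qed simp

section \<open>Reflections in hyperplanes\<close>

lemma scalar_prod_self_eq_0:
  fixes x :: "real vec"
  assumes "x \<in> carrier_vec d"
  shows "x \<bullet> x = 0 \<longleftrightarrow> x = 0\<^sub>v d"
proof
  assume "x \<bullet> x = 0"
  then have "\<forall>i<d. x $ i = 0"
    using assms by (simp add: scalar_prod_def sum_nonneg_eq_0_iff atLeast0LessThan)
  then show "x = 0\<^sub>v d"
    using assms by (intro eq_vecI) auto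
qed simp

lemma scalar_prod_self_nonneg: "0 \<le> (x :: real vec) \<bullet> x"
  by (simp add: scalar_prod_def sum_nonneg)

text \<open>If \<open>w \<bullet> w = 0\<close>, the quotient is \<open>0\<close> by the convention
  for division and the map is the identity. The properties below thus hold for every
  \<open>w\<close>, including the difference of two equal vectors.\<close>

definition reflect :: "real vec \<Rightarrow> real vec \<Rightarrow> real vec" where
  "reflect w x = x - (2 * (w \<bullet> x) / (w \<bullet> w)) \<cdot>\<^sub>v w"

context
  fixes d :: nat and w :: "real vec"
  assumes w: "w \<in> carrier_vec d"
begin

lemma reflect_carrier: "x \<in> carrier_vec d \<Longrightarrow> reflect w x \<in> carrier_vec d"
  using w by (simp add: reflect_def)

lemma reflect_add:
  "x \<in> carrier_vec d \<Longrightarrow> y \<in> carrier_vec d \<Longrightarrow> reflect w (x + y) = reflect w x + reflect w y"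
  using w by (intro eq_vecI)
    (auto simp: reflect_def scalar_prod_add_distrib[of _ d] add_divide_distrib algebra_simps)

lemma reflect_scalar_prod:
  "x \<in> carrier_vec d \<Longrightarrow> y \<in> carrier_vec d \<Longrightarrow>
    reflect w x \<bullet> y = x \<bullet> y - 2 * (w \<bullet> x) * (w \<bullet> y) / (w \<bullet> w)"
  using w by (simp add: reflect_def minus_scalar_prod_distrib[of _ d])

lemma reflect_self_adjoint:
  "x \<in> carrier_vec d \<Longrightarrow> y \<in> carrier_vec d \<Longrightarrow> reflect w x \<bullet> y = x \<bullet> reflect w y"
  using w by (simp add: reflect_scalar_prod comm_scalar_prod[of x d] reflect_carrier)

lemma reflect_involution:
  assumes "x \<in> carrier_vec d"
  shows "reflect w (reflect w x) = x"
proof (cases "w \<bullet> w = 0")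
  case True
  then show ?thesis
    using assms w by (auto simp: reflect_def intro!: eq_vecI)
next
  case False
  have "w \<bullet> reflect w x = - (w \<bullet> x)"
    using assms w False
    by (simp add: comm_scalar_prod[of w d "reflect w x"] reflect_carrier reflect_scalar_prod comm_scalar_prod[of x d w])
  then have "reflect w (reflect w x) = reflect w x - (- (2 * (w \<bullet> x)) / (w \<bullet> w)) \<cdot>\<^sub>v w"
    by (simp add: reflect_def[of w "reflect w x"])
  then show ?thesis
    using assms w by (auto simp: reflect_def intro!: eq_vecI)
qed

lemma reflect_isometry:
  "x \<in> carrier_vec d \<Longrightarrow> y \<in> carrier_vec d \<Longrightarrow> reflect w x \<bullet> reflect w y = x \<bullet> y"
  by (simp add: reflect_self_adjoint reflect_carrier reflect_involution)

lemma reflect_orthogonal: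
  "x \<in> carrier_vec d \<Longrightarrow> w \<bullet> x = 0 \<Longrightarrow> reflect w x = x"
  using w by (auto simp: reflect_def intro!: eq_vecI)

lemma measurable_reflect: "reflect w \<in> measurable (borel_vec d) (borel_vec d)"
proof -
  have [measurable]: "(\<lambda>x. w \<bullet> x) \<in> borel_measurable (borel_vec d)"
    using w by (intro borel_measurable_scalar_prod[where d=d]) auto
  have "(\<lambda>x. x - (2 * (w \<bullet> x) / (w \<bullet> w)) \<cdot>\<^sub>v w) \<in> measurable (borel_vec d) (borel_vec d)"
    using w by (intro borel_vec_measurable_diff borel_vec_measurable_smult) auto
  then show ?thesis
    by (simp add: reflect_def[abs_def])
qed

end

text \<open>Equal lengths make the squared length of \<open>a - b\<close> twice its inner product
  with \<open>a\<close>, so the reflection subtracts exactly \<open>a - b\<close>. This makes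
  reflections transitive on spheres.\<close>

lemma reflect_diff_swap:
  assumes a: "a \<in> carrier_vec d" and b: "b \<in> carrier_vec d" and eq: "a \<bullet> a = b \<bullet> b"
  shows "reflect (a - b) a = b"
proof -
  let ?w = "a - b"
  have w: "?w \<in> carrier_vec d" using a b by simp
  have ba: "b \<bullet> a = a \<bullet> b" using a b by (simp add: comm_scalar_prod[of b d])
  have 1: "?w \<bullet> a = a \<bullet> a - a \<bullet> b" using a b by (simp add: minus_scalar_prod_distrib[of _ d] ba)
  have 2: "?w \<bullet> ?w = 2 * (a \<bullet> a - a \<bullet> b)"
    using a b eq by (simp add: minus_scalar_prod_distrib[of _ d] scalar_prod_minus_distrib[of _ d] ba)
  show ?thesis
  proof (cases "?w \<bullet> ?w = 0")
    case True
    then have "?w = 0\<^sub>v d" using scalar_prod_self_eq_0[OF w] by simp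
    then have "a $ i = b $ i" if "i < d" for i
      using a b that index_minus_vec(1)[of i b a] by simp
    then have "a = b" using a b by (intro eq_vecI) auto
    moreover have "reflect ?w a = a"
      using a b True by (auto simp: reflect_def intro!: eq_vecI)
    ultimately show ?thesis by simp
  next
    case False
    then have "2 * (?w \<bullet> a) / (?w \<bullet> ?w) = 1" by (simp add: 1 2)
    then show ?thesis
      using a b by (auto simp: reflect_def intro!: eq_vecI)
  qed
qed

lemma distr_std_normal_vec_reflect:
  assumes "w \<in> carrier_vec d"
  shows "distr (std_normal_vec d) (borel_vec d) (reflect w) = std_normal_vec d"
  using assms
  by (intro distr_std_normal_vec_isometry measurable_reflect reflect_add reflect_involution reflect_isometry)

section \<open>Projections and moments of the standard normal vector\<close>

lemma prob_space_std_normal: "prob_space std_normal_distribution"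
  by (simp add: prob_space_normal_density)

lemma measurable_vec_std_normal:
  "vec d \<in> measurable (\<Pi>\<^sub>M k\<in>{..<d}. std_normal_distribution) (borel_vec d)"
  using measurable_vec by (rule measurable_cong_sets[THEN equalityD2, THEN subsetD, rotated 2]) (auto intro!: sets_PiM_cong)

text \<open>A reflection carries the first basis vector to \<open>a\<close>. Moving it to the other
  factor turns \<open>a \<bullet> z\<close> into one coordinate of a reflected vector, which is
  again standard normal.\<close>

lemma distr_std_normal_vec_scalar_prod:
  assumes a: "a \<in> carrier_vec d" and unit: "a \<bullet> a = 1"
  shows "distr (std_normal_vec d) borel (\<lambda>z. a \<bullet> z) = std_normal_distribution"
proof -
  have d: "0 < d"
    using a unit by (cases d) (auto simp: scalar_prod_def)
  define e where "e = (unit_vec d 0 :: real vec)"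
  have e: "e \<in> carrier_vec d" "e \<bullet> e = 1" using d by (auto simp: e_def)
  define w where "w = e - a"
  have w: "w \<in> carrier_vec d" using a e by (simp add: w_def)
  have "reflect w e = a"
    unfolding w_def using a e unit by (intro reflect_diff_swap) auto
  then have az: "a \<bullet> z = reflect w z $ 0" if "z \<in> carrier_vec d" for z
    using reflect_self_adjoint[OF w e(1) that] reflect_carrier[OF w that] d
    by (simp add: e_def)
  have c: "(\<lambda>z. z $ 0) \<in> borel_measurable (borel_vec d)"
    using d by (intro measurable_vec_index[where d=d]) auto
  have "distr (std_normal_vec d) borel (\<lambda>z. a \<bullet> z) = distr (std_normal_vec d) borel (\<lambda>z. reflect w z $ 0)"
    by (intro distr_cong) (auto simp: az)
  also have "\<dots> = distr (distr (std_normal_vec d) (borel_vec d) (reflect w)) borel (\<lambda>z. z $ 0)"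
    using measurable_reflect[OF w] by (subst distr_distr[OF c]) (simp_all add: comp_def)
  also have "\<dots> = distr (\<Pi>\<^sub>M k\<in>{..<d}. std_normal_distribution) borel (\<lambda>x. vec d x $ 0)"
    by (subst distr_std_normal_vec_reflect[OF w], unfold std_normal_vec_def,
        subst distr_distr[OF c measurable_vec_std_normal]) (simp add: comp_def)
  also have "\<dots> = distr (\<Pi>\<^sub>M k\<in>{..<d}. std_normal_distribution) std_normal_distribution (\<lambda>x. x 0)"
    using d by (intro distr_cong) auto
  also have "\<dots> = std_normal_distribution"
    using d prob_space_std_normal by (intro distr_PiM_component) auto
  finally show ?thesis .
qed

lemma std_normal_second_moment:
  "integrable std_normal_distribution (\<lambda>x. x\<^sup>2)" "(LINT x|std_normal_distribution. x\<^sup>2) = 1"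
  using std_normal_distribution_even_moments[of 1] by (simp_all add: fact_numeral)

lemma std_normal_fourth_moment:
  "integrable std_normal_distribution (\<lambda>x. x^4)" "(LINT x|std_normal_distribution. x^4) = 3"
  using std_normal_distribution_even_moments[of 2] by (simp_all add: fact_numeral)

lemma std_normal_vec_scalar_prod_moment:
  assumes a: "a \<in> carrier_vec d" and unit: "a \<bullet> a = 1"
  shows "integrable (std_normal_vec d) (\<lambda>z. (a \<bullet> z)\<^sup>2)" (is ?I)
    and "(LINT z|std_normal_vec d. (a \<bullet> z)\<^sup>2) = 1" (is ?E)
proof -
  have m: "(\<lambda>z. a \<bullet> z) \<in> measurable (std_normal_vec d) borel"
    using a by (auto intro!: borel_measurable_scalar_prod[where d=d])
  show ?I
    using std_normal_second_moment(1) unfolding distr_std_normal_vec_scalar_prod[OF assms, symmetric]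
    by (subst (asm) integrable_distr_eq[OF m]) auto
  show ?E
    using std_normal_second_moment(2) unfolding distr_std_normal_vec_scalar_prod[OF assms, symmetric]
    by (subst (asm) integral_distr[OF m]) auto
qed

lemma std_normal_chi_square_term:
  "integrable std_normal_distribution (\<lambda>x. x\<^sup>2 - 1)" "(LINT x|std_normal_distribution. x\<^sup>2 - 1) = 0"
  "integrable std_normal_distribution (\<lambda>x. (x\<^sup>2 - 1) * (x\<^sup>2 - 1))"
  "(LINT x|std_normal_distribution. (x\<^sup>2 - 1) * (x\<^sup>2 - 1)) = 2"
proof -
  interpret N: prob_space std_normal_distribution by (rule prob_space_std_normal)
  note [simp] = std_normal_second_moment std_normal_fourth_moment
  have 1: "integrable std_normal_distribution (\<lambda>x. 1 :: real)" by simp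
  have [simp]: "measure std_normal_distribution UNIV = 1" using N.prob_space by simp
  show "integrable std_normal_distribution (\<lambda>x. x\<^sup>2 - 1)" "(LINT x|std_normal_distribution. x\<^sup>2 - 1) = 0"
    using 1 by (simp_all del: integrable_const)
  have eq: "(x\<^sup>2 - 1) * (x\<^sup>2 - 1) = x^4 - 2 * x\<^sup>2 + 1" for x :: real
    by (simp add: algebra_simps power2_eq_square power4_eq_xxxx)
  show "integrable std_normal_distribution (\<lambda>x. (x\<^sup>2 - 1) * (x\<^sup>2 - 1))"
    "(LINT x|std_normal_distribution. (x\<^sup>2 - 1) * (x\<^sup>2 - 1)) = 2"
    unfolding eq using 1 by (simp_all del: integrable_const)
qed

lemma std_normal_PiM_chi_square_cov:
  fixes d k l :: nat
  assumes k: "k < d" and l: "l < d"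
  defines "f \<equiv> \<lambda>x::real. x\<^sup>2 - 1"
  shows "integrable (\<Pi>\<^sub>M i\<in>{..<d}. std_normal_distribution) (\<lambda>x. f (x k) * f (x l))" (is ?I)
    and "(LINT x|(\<Pi>\<^sub>M i\<in>{..<d}. std_normal_distribution). f (x k) * f (x l)) = (if k = l then 2 else 0)" (is ?E)
proof -
  interpret N: prob_space std_normal_distribution by (rule prob_space_std_normal)
  interpret P: product_sigma_finite "\<lambda>_::nat. std_normal_distribution" by standard
  \<comment> \<open>The factors of the integrand by coordinate. Merging the two factors when
    \<open>k = l\<close> lets one product formula give both the variance and the vanishing
    covariance.\<close>
  define g where "g i x = (if i = k \<and> i = l then f x * f x else if i = k \<or> i = l then f x else 1)" for i x
  have prod: "(\<Prod>i\<in>{..<d}. g i (x i)) = f (x k) * f (x l)" for x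
  proof -
    have "(\<Prod>i\<in>{..<d}. g i (x i)) = (\<Prod>i\<in>{k, l}. g i (x i))"
      using k l by (intro prod.mono_neutral_right) (auto simp: g_def)
    then show ?thesis by (cases "k = l") (auto simp: g_def)
  qed
  have int: "integrable std_normal_distribution (g i)" for i
    using std_normal_chi_square_term
    by (cases "i = k"; cases "i = l") (simp_all add: g_def[abs_def] f_def)
  show ?I
    unfolding prod[symmetric] using int by (intro P.product_integrable_prod) auto
  have "(LINT x|(\<Pi>\<^sub>M i\<in>{..<d}. std_normal_distribution). f (x k) * f (x l))
      = (\<Prod>i<d. LINT x|std_normal_distribution. g i x)"
    unfolding prod[symmetric] using int by (intro P.product_integral_prod) auto
  also have "\<dots> = (\<Prod>i\<in>{k, l}. LINT x|std_normal_distribution. g i x)"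
    using k l N.prob_space by (intro prod.mono_neutral_right) (auto simp: g_def)
  also have "\<dots> = (if k = l then 2 else 0)"
    using std_normal_chi_square_term by (auto simp: g_def f_def)
  finally show ?E .
qed

text \<open>\<open>z \<bullet> z - real d\<close> is a sum of \<open>d\<close> uncorrelated centred
  terms of variance \<open>2\<close>. Its deviation of order \<open>sqrt d\<close> means that the
  length of \<open>z\<close> is \<open>sqrt d\<close> up to a bounded error.\<close>

lemma std_normal_vec_norm_moments:
  shows "integrable (std_normal_vec d) (\<lambda>z. z \<bullet> z)" (is ?I1)
    and "(LINT z|std_normal_vec d. z \<bullet> z) = real d" (is ?E1)
    and "integrable (std_normal_vec d) (\<lambda>z. (z \<bullet> z - real d)\<^sup>2)" (is ?I2)
    and "(LINT z|std_normal_vec d. (z \<bullet> z - real d)\<^sup>2) = 2 * real d" (is ?E2)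
proof -
  let ?P = "\<Pi>\<^sub>M k\<in>{..<d}. std_normal_distribution"
  interpret G: prob_space "std_normal_vec d" by (rule prob_space_std_normal_vec)
  have [measurable]: "(\<lambda>z. z \<bullet> z) \<in> borel_measurable (borel_vec d)"
    by (rule borel_measurable_scalar_prod[OF measurable_borel_vec_id measurable_borel_vec_id])
  have zz: "vec d x \<bullet> vec d x - real d = (\<Sum>k<d. (x k)\<^sup>2 - 1)" for x :: "nat \<Rightarrow> real"
    by (simp add: scalar_prod_def power2_eq_square atLeast0LessThan sum_subtractf)
  have sq: "(vec d x \<bullet> vec d x - real d)\<^sup>2 = (\<Sum>k<d. \<Sum>l<d. ((x k)\<^sup>2 - 1) * ((x l)\<^sup>2 - 1))" for x :: "nat \<Rightarrow> real"
    by (simp add: zz power2_eq_square[of "sum _ _"] sum_product)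
  show ?I2
    unfolding std_normal_vec_def
    by (subst integrable_distr_eq[OF measurable_vec_std_normal])
       (auto simp: sq intro!: Bochner_Integration.integrable_sum std_normal_PiM_chi_square_cov)
  have "(LINT z|std_normal_vec d. (z \<bullet> z - real d)\<^sup>2)
      = (LINT x|?P. (\<Sum>k<d. \<Sum>l<d. ((x k)\<^sup>2 - 1) * ((x l)\<^sup>2 - 1)))"
    unfolding std_normal_vec_def
    by (subst integral_distr[OF measurable_vec_std_normal]) (simp_all add: sq)
  also have "\<dots> = (\<Sum>k<d. LINT x|?P. (\<Sum>l<d. ((x k)\<^sup>2 - 1) * ((x l)\<^sup>2 - 1)))"
    by (intro Bochner_Integration.integral_sum Bochner_Integration.integrable_sum std_normal_PiM_chi_square_cov) auto
  also have "\<dots> = (\<Sum>k<d. \<Sum>l<d. LINT x|?P. ((x k)\<^sup>2 - 1) * ((x l)\<^sup>2 - 1))"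
    by (intro sum.cong refl Bochner_Integration.integral_sum std_normal_PiM_chi_square_cov) auto
  also have "\<dots> = (\<Sum>k<d. \<Sum>l<d. if k = l then 2 else 0)"
    by (intro sum.cong refl std_normal_PiM_chi_square_cov) auto
  finally show ?E2 by simp
  have u: "unit_vec d k \<in> carrier_vec d" "unit_vec d k \<bullet> unit_vec d k = (1::real)" if "k < d" for k
    using that by auto
  have zu: "z \<bullet> z = (\<Sum>k<d. (unit_vec d k \<bullet> z)\<^sup>2)" if "z \<in> carrier_vec d" for z :: "real vec"
    using that by (simp add: scalar_prod_def[of z z] power2_eq_square atLeast0LessThan)
  have "integrable (std_normal_vec d) (\<lambda>z. \<Sum>k<d. (unit_vec d k \<bullet> z)\<^sup>2)"
    using u by (auto intro!: std_normal_vec_scalar_prod_moment)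
  then show ?I1
    by (rule Bochner_Integration.integrable_cong[THEN iffD1, rotated 2]) (auto simp: zu)
  have "(LINT z|std_normal_vec d. z \<bullet> z) = (LINT z|std_normal_vec d. (\<Sum>k<d. (unit_vec d k \<bullet> z)\<^sup>2))"
    by (intro Bochner_Integration.integral_cong) (auto simp: zu)
  also have "\<dots> = real d"
    using u by (subst Bochner_Integration.integral_sum) (auto intro!: std_normal_vec_scalar_prod_moment simp: std_normal_vec_scalar_prod_moment)
  finally show ?E1 .
qed

text \<open>The inequality is the nonnegativity of the variance of the absolute value.\<close>

lemma (in prob_space) expectation_abs_le_sqrt:
  fixes X :: "'a \<Rightarrow> real"
  assumes [measurable]: "X \<in> borel_measurable M" and int: "integrable M (\<lambda>x. (X x)\<^sup>2)"
  shows "integrable M X" and "expectation (\<lambda>x. \<bar>X x\<bar>) \<le> sqrt (expectation (\<lambda>x. (X x)\<^sup>2))"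
proof -
  have "norm (X x) \<le> norm (1 + (X x)\<^sup>2)" for x
  proof -
    have "0 \<le> (\<bar>X x\<bar> - 1)\<^sup>2 + \<bar>X x\<bar>" by simp
    then have "\<bar>X x\<bar> \<le> 1 + (X x)\<^sup>2" by (simp add: power2_diff)
    then show ?thesis by simp
  qed
  moreover have "integrable M (\<lambda>x. 1 + (X x)\<^sup>2)" using int by simp
  ultimately show X: "integrable M X"
    by (intro Bochner_Integration.integrable_bound[where g=X]) (auto intro!: AE_I2)
  have "0 \<le> variance (\<lambda>x. \<bar>X x\<bar>)" by (rule variance_positive)
  also have "\<dots> = expectation (\<lambda>x. (X x)\<^sup>2) - (expectation (\<lambda>x. \<bar>X x\<bar>))\<^sup>2"
    using X int by (subst variance_eq) auto
  finally show "expectation (\<lambda>x. \<bar>X x\<bar>) \<le> sqrt (expectation (\<lambda>x. (X x)\<^sup>2))"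
    by (intro real_le_rsqrt) simp
qed

section \<open>Laws invariant under rotations around an axis\<close>

lemma scalar_prod_Cauchy_Schwarz:
  fixes x y :: "real vec"
  assumes "x \<in> carrier_vec d" "y \<in> carrier_vec d"
  shows "(x \<bullet> y)\<^sup>2 \<le> (x \<bullet> x) * (y \<bullet> y)"
  using Cauchy_Schwarz_ineq_sum[of "\<lambda>i. x $ i" "\<lambda>i. y $ i" "{0..<d}"] assms
  by (simp add: scalar_prod_def power2_eq_square)

lemma cmod_iexp_diff_le: "cmod (iexp x - iexp y) \<le> \<bar>x - y\<bar>"
proof -
  have "iexp x - iexp y = iexp y * (iexp (x - y) - 1)"
    by (simp add: algebra_simps exp_add[symmetric])
  then have "cmod (iexp x - iexp y) = cmod (iexp (x - y) - 1)"
    by (simp add: norm_mult)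
  also have "\<dots> \<le> \<bar>x - y\<bar>"
    using iexp_approx1[of "x - y" 0] by simp
  finally show ?thesis .
qed

text \<open>The junk value at \<open>v = 0\<close> is \<open>0\<close>.\<close>

definition vec_component :: "real vec \<Rightarrow> real vec \<Rightarrow> real" where
  "vec_component a v = (a \<bullet> v) / vec_norm2 v"

lemma vec_norm2_power2: "(vec_norm2 v)\<^sup>2 = v \<bullet> v"
  by (simp add: vec_norm2_def scalar_prod_self_nonneg)

lemma vec_norm2_nonneg: "0 \<le> vec_norm2 v"
  by (simp add: vec_norm2_def scalar_prod_self_nonneg)

lemma vec_norm2_eq_0: "v \<in> carrier_vec d \<Longrightarrow> vec_norm2 v = 0 \<longleftrightarrow> v = 0\<^sub>v d"
  by (simp add: vec_norm2_def scalar_prod_self_eq_0)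

lemma measurable_vec_norm2:
  assumes "f \<in> measurable M (borel_vec d)"
  shows "(\<lambda>w. vec_norm2 (f w)) \<in> borel_measurable M"
proof -
  have [measurable]: "(\<lambda>w. f w \<bullet> f w) \<in> borel_measurable M"
    by (rule borel_measurable_scalar_prod[OF assms assms])
  show ?thesis
    unfolding vec_norm2_def by measurable
qed

lemma measurable_vec_component:
  "f \<in> measurable M (borel_vec d) \<Longrightarrow> g \<in> measurable M (borel_vec d) \<Longrightarrow>
    (\<lambda>w. vec_component (f w) (g w)) \<in> borel_measurable M"
  unfolding vec_component_def
  by (intro borel_measurable_divide measurable_vec_norm2[where d=d] borel_measurable_scalar_prod[where d=d])

lemma vec_component_smult:
  "a \<in> carrier_vec d \<Longrightarrow> v \<in> carrier_vec d \<Longrightarrow> vec_component (s \<cdot>\<^sub>v a) v = s * vec_component a v"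
  by (simp add: vec_component_def)

lemma vec_component_eq_unit:
  assumes "a \<in> carrier_vec d" "v \<in> carrier_vec d"
  shows "vec_component a v = ((1 / vec_norm2 v) \<cdot>\<^sub>v v) \<bullet> a"
  using assms by (simp add: vec_component_def comm_scalar_prod[of v d a])

lemma normalized_scalar_prod:
  assumes "v \<in> carrier_vec d" "v \<noteq> 0\<^sub>v d"
  shows "((1 / vec_norm2 v) \<cdot>\<^sub>v v) \<bullet> ((1 / vec_norm2 v) \<cdot>\<^sub>v v) = 1"
  using assms vec_norm2_eq_0[OF assms(1)]
  by (simp add: vec_norm2_power2[of v, symmetric] power2_eq_square)

lemma vec_component_power2_le:
  assumes "a \<in> carrier_vec d" "v \<in> carrier_vec d"
  shows "(vec_component a v)\<^sup>2 \<le> a \<bullet> a"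
proof (cases "v = 0\<^sub>v d")
  case True
  then show ?thesis using assms by (simp add: vec_component_def scalar_prod_self_nonneg)
next
  case False
  then have "0 < v \<bullet> v"
    using scalar_prod_self_eq_0[OF assms(2)] scalar_prod_self_nonneg[of v] by simp
  then show ?thesis
    using scalar_prod_Cauchy_Schwarz[OF assms]
    by (simp add: vec_component_def power_divide vec_norm2_power2 divide_le_eq)
qed

text \<open>The law of the residual, detached from its statistical origin. The admissible
  reflections are those fixing \<open>\<theta>\<close>, because a reflected sample has to keep its
  responses; they generate all orthogonal maps that fix the axis.\<close>

locale axial_law = prob_space N
  for N :: "real vec measure" +
  fixes d :: nat and \<theta> :: "real vec"
  assumes sets_N [measurable_cong]: "sets N = sets (borel_vec d)"
    and axis: "\<theta> \<in> carrier_vec d" and axis_unit: "\<theta> \<bullet> \<theta> = 1"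
    and axis_orthogonal: "AE v in N. \<theta> \<bullet> v = 0"
    and reflect_invariant: "\<And>w. w \<in> carrier_vec d \<Longrightarrow> w \<bullet> \<theta> = 0 \<Longrightarrow> distr N (borel_vec d) (reflect w) = N"
begin

lemma space_N: "space N = carrier_vec d"
  using sets_eq_imp_space_eq[OF sets_N] by simp

lemma measurable_N: "measurable N K = measurable (borel_vec d) K"
  by (rule measurable_cong_sets) (simp_all add: sets_N)

lemma component_measurable: "a \<in> carrier_vec d \<Longrightarrow> vec_component a \<in> borel_measurable N"
  unfolding measurable_N by (rule measurable_vec_component[where d=d]) auto

text \<open>The reflection in \<open>a - b\<close> is admissible since both vectors are orthogonal
  to the axis. It takes \<open>a\<close> to \<open>b\<close>, preserves the length of
  \<open>v\<close>, and by self-adjointness can be moved from \<open>v\<close> to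
  \<open>a\<close>.\<close>

lemma distr_component_eq:
  assumes a: "a \<in> carrier_vec d" "a \<bullet> \<theta> = 0" and b: "b \<in> carrier_vec d" "b \<bullet> \<theta> = 0"
    and eq: "a \<bullet> a = b \<bullet> b"
  shows "distr N borel (vec_component a) = distr N borel (vec_component b)"
proof -
  define w where "w = a - b"
  have w: "w \<in> carrier_vec d" "w \<bullet> \<theta> = 0"
    using a b axis by (auto simp: w_def minus_scalar_prod_distrib[of _ d])
  have ra: "reflect w a = b"
    unfolding w_def by (rule reflect_diff_swap[OF a(1) b(1) eq])
  have R: "reflect w \<in> measurable N (borel_vec d)"
    unfolding measurable_N by (rule measurable_reflect[OF w(1)])
  have A: "vec_component a \<in> borel_measurable (borel_vec d)"
    using component_measurable[OF a(1)] by (simp add: measurable_N)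
  have "distr N borel (vec_component a) = distr (distr N (borel_vec d) (reflect w)) borel (vec_component a)"
    by (simp add: reflect_invariant[OF w])
  also have "\<dots> = distr N borel (\<lambda>v. vec_component a (reflect w v))"
    by (subst distr_distr[OF A R]) (simp add: comp_def)
  also have "\<dots> = distr N borel (vec_component b)"
  proof (rule distr_cong[OF refl refl])
    fix v assume "v \<in> space N"
    then have v: "v \<in> carrier_vec d" by (simp add: space_N)
    show "vec_component a (reflect w v) = vec_component b v"
      using a w v by (simp add: vec_component_def vec_norm2_def reflect_isometry[OF w(1)]
          reflect_self_adjoint[OF w(1) a(1), symmetric] ra)
  qed
  finally show ?thesis .
qed

lemma integral_component_eq:
  fixes f :: "real \<Rightarrow> 'b :: {banach, second_countable_topology}"
  assumes "a \<in> carrier_vec d" "a \<bullet> \<theta> = 0" "b \<in> carrier_vec d" "b \<bullet> \<theta> = 0" "a \<bullet> a = b \<bullet> b"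
    and f: "f \<in> borel_measurable borel"
  shows "(LINT v|N. f (vec_component a v)) = (LINT v|N. f (vec_component b v))"
  using distr_component_eq[OF assms(1-5)] integral_distr[OF component_measurable[OF assms(1)] f]
    integral_distr[OF component_measurable[OF assms(3)] f]
  by simp

section \<open>Projection off the axis and averages over normal directions\<close>

definition perp :: "real vec \<Rightarrow> real vec" where
  "perp z = z - (\<theta> \<bullet> z) \<cdot>\<^sub>v \<theta>"

lemma perp_carrier: "z \<in> carrier_vec d \<Longrightarrow> perp z \<in> carrier_vec d"
  using axis by (simp add: perp_def)

lemma perp_axis: "z \<in> carrier_vec d \<Longrightarrow> perp z \<bullet> \<theta> = 0"
  using axis by (simp add: perp_def minus_scalar_prod_distrib[of _ d] axis_unit comm_scalar_prod[of z d \<theta>])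

lemma perp_norm: "z \<in> carrier_vec d \<Longrightarrow> perp z \<bullet> perp z = z \<bullet> z - (\<theta> \<bullet> z)\<^sup>2"
  using axis
  by (simp add: perp_def minus_scalar_prod_distrib[of _ d] scalar_prod_minus_distrib[of _ d] axis_unit
      comm_scalar_prod[of z d \<theta>] power2_eq_square)

lemma component_perp:
  assumes "z \<in> carrier_vec d"
  shows "AE v in N. vec_component (perp z) v = vec_component z v"
  using axis_orthogonal AE_space
proof eventually_elim
  case (elim v)
  then have "perp z \<bullet> v = z \<bullet> v"
    using assms axis by (simp add: space_N perp_def minus_scalar_prod_distrib[of _ d])
  then show ?case by (simp add: vec_component_def)
qed

text \<open>Almost every \<open>v\<close> is orthogonal to the axis, so \<open>z\<close> may be
  replaced by \<open>perp z\<close>, and then by a multiple of \<open>e\<close> of the same length.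
  With \<open>e\<close> fixed, the dependence on \<open>z\<close> becomes a scaling of a single
  law.\<close>

lemma integral_component_perp:
  fixes f :: "real \<Rightarrow> 'b :: {banach, second_countable_topology}"
  assumes e: "e \<in> carrier_vec d" "e \<bullet> \<theta> = 0" "e \<bullet> e = 1" and z: "z \<in> carrier_vec d"
    and f: "f \<in> borel_measurable borel"
  shows "(LINT v|N. f (vec_component z v)) = (LINT v|N. f (vec_norm2 (perp z) * vec_component e v))"
proof -
  have "(LINT v|N. f (vec_component z v)) = (LINT v|N. f (vec_component (perp z) v))"
    using component_perp[OF z] measurable_compose[OF component_measurable f] z perp_carrier[OF z]
    by (intro integral_cong_AE) (auto elim!: eventually_mono)
  also have "\<dots> = (LINT v|N. f (vec_component (vec_norm2 (perp z) \<cdot>\<^sub>v e) v))"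
    using e z axis by (intro integral_component_eq perp_carrier perp_axis f)
      (simp_all add: e vec_norm2_power2[of "perp z", symmetric] power2_eq_square)
  also have "\<dots> = (LINT v|N. f (vec_norm2 (perp z) * vec_component e v))"
    using e by (intro Bochner_Integration.integral_cong) (auto simp: vec_component_smult[of _ d] space_N)
  finally show ?thesis .
qed

text \<open>The number \<open>s\<close> is later the squared length of a deterministic vector. The
  three terms bound its offset from \<open>d\<close>, the fluctuation of
  \<open>z \<bullet> z\<close>, and the mean \<open>1\<close> of
  \<open>(\<theta> \<bullet> z)\<^sup>2\<close>, which the projection removes.\<close>

lemma perp_moments:
  shows "integrable (std_normal_vec d) (\<lambda>z. perp z \<bullet> perp z)"
    and "(LINT z|std_normal_vec d. perp z \<bullet> perp z) = real d - 1"
    and "(LINT z|std_normal_vec d. \<bar>perp z \<bullet> perp z - s\<bar>) \<le> \<bar>real d - s\<bar> + sqrt (2 * real d) + 1"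
proof -
  interpret G: prob_space "std_normal_vec d" by (rule prob_space_std_normal_vec)
  note m = std_normal_vec_norm_moments[of d]
  note \<theta> = std_normal_vec_scalar_prod_moment[OF axis axis_unit]
  have [measurable]: "(\<lambda>z. z \<bullet> z) \<in> borel_measurable (std_normal_vec d)"
    using m(1) by (rule borel_measurable_integrable)
  have i: "integrable (std_normal_vec d) (\<lambda>z. z \<bullet> z - (\<theta> \<bullet> z)\<^sup>2)"
    using m \<theta> by simp
  then show I: "integrable (std_normal_vec d) (\<lambda>z. perp z \<bullet> perp z)"
    by (rule Bochner_Integration.integrable_cong[THEN iffD1, rotated 2]) (auto simp: perp_norm)
  have "(LINT z|std_normal_vec d. perp z \<bullet> perp z) = (LINT z|std_normal_vec d. z \<bullet> z - (\<theta> \<bullet> z)\<^sup>2)"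
    by (intro Bochner_Integration.integral_cong) (auto simp: perp_norm)
  then show "(LINT z|std_normal_vec d. perp z \<bullet> perp z) = real d - 1"
    using m \<theta> by simp
  have ab: "integrable (std_normal_vec d) (\<lambda>z. \<bar>z \<bullet> z - real d\<bar>)"
    using m by simp
  have le: "(LINT z|std_normal_vec d. \<bar>z \<bullet> z - real d\<bar>) \<le> sqrt (2 * real d)"
    using G.expectation_abs_le_sqrt(2)[of "\<lambda>z. z \<bullet> z - real d"] m by simp
  have "(LINT z|std_normal_vec d. \<bar>perp z \<bullet> perp z - s\<bar>)
      \<le> (LINT z|std_normal_vec d. \<bar>real d - s\<bar> + \<bar>z \<bullet> z - real d\<bar> + (\<theta> \<bullet> z)\<^sup>2)"
  proof (rule integral_mono)
    show "\<bar>perp z \<bullet> perp z - s\<bar> \<le> \<bar>real d - s\<bar> + \<bar>z \<bullet> z - real d\<bar> + (\<theta> \<bullet> z)\<^sup>2"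
      if "z \<in> space (std_normal_vec d)" for z
    proof -
      have "0 \<le> (\<theta> \<bullet> z)\<^sup>2" by simp
      moreover have "perp z \<bullet> perp z = z \<bullet> z - (\<theta> \<bullet> z)\<^sup>2" using that by (simp add: perp_norm)
      ultimately show ?thesis by linarith
    qed
  qed (use I ab \<theta> in auto)
  also have "\<dots> = \<bar>real d - s\<bar> + (LINT z|std_normal_vec d. \<bar>z \<bullet> z - real d\<bar>) + 1"
    using ab \<theta> G.prob_space by simp
  finally show "(LINT z|std_normal_vec d. \<bar>perp z \<bullet> perp z - s\<bar>) \<le> \<bar>real d - s\<bar> + sqrt (2 * real d) + 1"
    using le by linarith
qed

lemma integrable_component_power2:
  "a \<in> carrier_vec d \<Longrightarrow> integrable N (\<lambda>v. (vec_component a v)\<^sup>2)"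
  using component_measurable[of a]
  by (intro integrable_const_bound[where B="a \<bullet> a"])
     (auto simp: vec_component_power2_le space_N)

text \<open>
  Averaging over a standard normal direction \<open>z\<close> independent of \<open>v\<close>: by invariance only the length
  of \<open>perp z\<close> matters, while for fixed \<open>v \<noteq> 0\<close> the component of \<open>z\<close> along \<open>v\<close> is standard normal.
\<close>

lemma component_second_moment_le:
  assumes e: "e \<in> carrier_vec d" "e \<bullet> \<theta> = 0" "e \<bullet> e = 1"
  shows "(real d - 1) * expectation (\<lambda>v. (vec_component e v)\<^sup>2) \<le> 1"
proof -
  let ?G = "std_normal_vec d"
  let ?q = "expectation (\<lambda>v. (vec_component e v)\<^sup>2)"
  interpret G: prob_space ?G by (rule prob_space_std_normal_vec)
  interpret GN: pair_prob_space ?G N by standard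
  have q: "0 \<le> ?q" by simp
  have fs: "fst \<in> measurable (?G \<Otimes>\<^sub>M N) (borel_vec d)" "snd \<in> measurable (?G \<Otimes>\<^sub>M N) (borel_vec d)"
    using measurable_fst[of ?G N] measurable_snd[of ?G N]
    by (simp_all cong: measurable_cong_sets add: sets_N)
  have m: "(\<lambda>(z, v). ennreal ((vec_component z v)\<^sup>2)) \<in> borel_measurable (?G \<Otimes>\<^sub>M N)"
    using measurable_vec_component[OF fs] by (simp add: split_beta)
  \<comment> \<open>The factor \<open>real d - 1\<close> is the mean of
    \<open>perp z \<bullet> perp z\<close>.\<close>
  have "ennreal ((real d - 1) * ?q) = (\<integral>\<^sup>+z. ennreal ((perp z \<bullet> perp z) * ?q) \<partial>?G)"
    using perp_moments(1,2) q
    by (subst nn_integral_eq_integral) (auto simp: scalar_prod_self_nonneg)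
  also have "\<dots> = (\<integral>\<^sup>+z. (\<integral>\<^sup>+v. ennreal ((vec_component z v)\<^sup>2) \<partial>N) \<partial>?G)"
  proof (rule nn_integral_cong)
    fix z assume "z \<in> space ?G"
    then have z: "z \<in> carrier_vec d" by simp
    have "(LINT v|N. (vec_component z v)\<^sup>2) = (LINT v|N. (vec_norm2 (perp z) * vec_component e v)\<^sup>2)"
      by (rule integral_component_perp[OF e z, where f="\<lambda>x. x\<^sup>2"]) measurable
    also have "\<dots> = (perp z \<bullet> perp z) * ?q"
      by (simp add: power_mult_distrib vec_norm2_power2)
    finally have "(LINT v|N. (vec_component z v)\<^sup>2) = (perp z \<bullet> perp z) * ?q" .
    then show "ennreal ((perp z \<bullet> perp z) * ?q) = (\<integral>\<^sup>+v. ennreal ((vec_component z v)\<^sup>2) \<partial>N)"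
      using integrable_component_power2[OF z] by (subst nn_integral_eq_integral) auto
  qed
  also have "\<dots> = (\<integral>\<^sup>+v. (\<integral>\<^sup>+z. ennreal ((vec_component z v)\<^sup>2) \<partial>?G) \<partial>N)"
    using GN.Fubini[OF m] by simp
  also have "\<dots> \<le> (\<integral>\<^sup>+v. 1 \<partial>N)"
  proof (rule nn_integral_mono)
    fix v assume "v \<in> space N"
    then have v: "v \<in> carrier_vec d" by (simp add: space_N)
    show "(\<integral>\<^sup>+z. ennreal ((vec_component z v)\<^sup>2) \<partial>?G) \<le> 1"
    \<comment> \<open>At \<open>v = 0\<close> the component has its default value, and the inner
      integral is \<open>0\<close> instead of \<open>1\<close>; hence an inequality and not an
      equation.\<close>
    proof (cases "v = 0\<^sub>v d")
      case True
      then have "vec_norm2 v = 0" using vec_norm2_eq_0[OF v] by simp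
      then show ?thesis by (simp add: vec_component_def)
    next
      case False
      let ?u = "(1 / vec_norm2 v) \<cdot>\<^sub>v v"
      have u: "?u \<in> carrier_vec d" "?u \<bullet> ?u = 1"
        using v by (simp, intro normalized_scalar_prod[OF v False])
      have "(\<integral>\<^sup>+z. ennreal ((vec_component z v)\<^sup>2) \<partial>?G) = (\<integral>\<^sup>+z. ennreal ((?u \<bullet> z)\<^sup>2) \<partial>?G)"
        using v by (intro nn_integral_cong) (simp only: vec_component_eq_unit[of _ d] space_std_normal_vec)
      also have "\<dots> = 1"
        using std_normal_vec_scalar_prod_moment[OF u] by (subst nn_integral_eq_integral) auto
      finally show ?thesis by simp
    qed
  qed
  also have "\<dots> = 1" by (simp add: emeasure_space_1)
  finally show ?thesis by simp
qed

text \<open>Fubini, read both ways: for fixed \<open>z\<close> the inner integral is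
  \<open>\<phi>\<close> at a multiple of the length of \<open>perp z\<close>, for fixed
  \<open>v\<close> it is the normal characteristic function. The point \<open>v = 0\<close>, where
  the exponential is constantly \<open>1\<close>, causes the whole error.\<close>

lemma gaussian_average_iexp_component:
  assumes e: "e \<in> carrier_vec d" "e \<bullet> \<theta> = 0" "e \<bullet> e = 1"
  defines "\<phi> \<equiv> \<lambda>s. (CLINT v|N. iexp (s * vec_component e v))"
  shows "integrable (std_normal_vec d) (\<lambda>z. \<phi> (t * vec_norm2 (perp z)))" (is ?I)
    and "cmod ((CLINT z|std_normal_vec d. \<phi> (t * vec_norm2 (perp z))) - exp (- (t\<^sup>2) / 2))
      \<le> prob {0\<^sub>v d}" (is ?E)
proof -
  let ?G = "std_normal_vec d"
  let ?f = "\<lambda>z v. iexp (t * vec_component z v)"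
  let ?r = "exp (- (t\<^sup>2) / 2)"
  let ?c = "complex_of_real ?r"
  interpret G: prob_space ?G by (rule prob_space_std_normal_vec)
  interpret GN: pair_prob_space ?G N by standard
  have fs: "fst \<in> measurable (?G \<Otimes>\<^sub>M N) (borel_vec d)" "snd \<in> measurable (?G \<Otimes>\<^sub>M N) (borel_vec d)"
    using measurable_fst[of ?G N] measurable_snd[of ?G N]
    by (simp_all cong: measurable_cong_sets add: sets_N)
  have [measurable]: "(\<lambda>x. vec_component (fst x) (snd x)) \<in> borel_measurable (?G \<Otimes>\<^sub>M N)"
    using measurable_vec_component[OF fs] .
  have int: "integrable (?G \<Otimes>\<^sub>M N) (case_prod ?f)"
    unfolding split_beta by (rule GN.integrable_const_bound[where B=1]) auto
  have \<phi>: "\<phi> (t * vec_norm2 (perp z)) = (CLINT v|N. ?f z v)" if "z \<in> carrier_vec d" for z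
    using integral_component_perp[OF e that, where f="\<lambda>x. iexp (t * x)"]
    by (simp add: \<phi>_def mult.assoc)
  show ?I
    using GN.integrable_fst[OF int]
    by (rule Bochner_Integration.integrable_cong[THEN iffD1, rotated 2]) (auto simp: \<phi>)
  have "{0\<^sub>v d} \<in> sets (borel_vec d)"
  proof -
    have "{v \<in> space (borel_vec d). vec_norm2 v = 0} \<in> sets (borel_vec d)"
      using measurable_vec_norm2[of "\<lambda>v. v" "borel_vec d" d] by measurable
    also have "{v \<in> space (borel_vec d). vec_norm2 v = 0} = {0\<^sub>v d}"
      using vec_norm2_eq_0[of _ d] by auto
    finally show ?thesis .
  qed
  then have z0: "{0\<^sub>v d} \<in> sets N" by (simp add: sets_N)
  have "(CLINT z|?G. \<phi> (t * vec_norm2 (perp z))) = (CLINT z|?G. CLINT v|N. ?f z v)"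
    by (intro Bochner_Integration.integral_cong) (auto simp: \<phi>)
  also have "\<dots> = (CLINT v|N. CLINT z|?G. ?f z v)"
    using GN.Fubini_integral[OF int] by simp
  also have "\<dots> = (CLINT v|N. ?c + (1 - ?c) * indicator {0\<^sub>v d} v)"
  proof (rule Bochner_Integration.integral_cong[OF refl])
    fix v assume "v \<in> space N"
    then have v: "v \<in> carrier_vec d" by (simp add: space_N)
    show "(CLINT z|?G. ?f z v) = ?c + (1 - ?c) * indicator {0\<^sub>v d} v"
    proof (cases "v = 0\<^sub>v d")
      case True
      then have "vec_norm2 v = 0" using vec_norm2_eq_0[OF v] by simp
      then have "(CLINT z|?G. ?f z v) = (CLINT z|?G. 1)"
        by (simp add: vec_component_def)
      then show ?thesis using True G.prob_space by simp
    next
      case False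
      let ?u = "(1 / vec_norm2 v) \<cdot>\<^sub>v v"
      have u: "?u \<in> carrier_vec d" "?u \<bullet> ?u = 1"
        using v by (simp, intro normalized_scalar_prod[OF v False])
      have um: "(\<lambda>z. ?u \<bullet> z) \<in> borel_measurable ?G"
        using u by (auto intro!: borel_measurable_scalar_prod[where d=d])
      have "(CLINT z|?G. ?f z v) = (CLINT z|?G. iexp (t * (?u \<bullet> z)))"
        using v by (intro Bochner_Integration.integral_cong refl) (simp only: vec_component_eq_unit[of _ d] space_std_normal_vec)
      also have "\<dots> = (CLINT x|distr ?G borel (\<lambda>z. ?u \<bullet> z). iexp (t * x))"
        by (subst integral_distr[OF um]) auto
      also have "\<dots> = char std_normal_distribution t"
        unfolding distr_std_normal_vec_scalar_prod[OF u] char_def ..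
      finally show ?thesis using False by (simp add: char_std_normal_distribution)
    qed
  qed
  also have "\<dots> = ?c + (1 - ?c) * prob {0\<^sub>v d}"
  proof -
    have "(CLINT v|N. ?c + (1 - ?c) * indicator {0\<^sub>v d} v)
        = (CLINT v|N. complex_of_real (?r + (1 - ?r) * indicator {0\<^sub>v d} v))"
      by (intro Bochner_Integration.integral_cong) (auto simp: indicator_def)
    also have "\<dots> = complex_of_real (LINT v|N. ?r + (1 - ?r) * indicator {0\<^sub>v d} v)"
      by (rule integral_complex_of_real)
    also have "(LINT v|N. ?r + (1 - ?r) * indicator {0\<^sub>v d} v) = ?r + (1 - ?r) * prob {0\<^sub>v d}"
      using z0 prob_space sets.sets_into_space[OF z0]
      by (subst Bochner_Integration.integral_add) (auto simp: Int_absorb2 emeasure_eq_measure intro!: integrable_real_indicator)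
    finally show ?thesis by simp
  qed
  finally have eq: "(CLINT z|?G. \<phi> (t * vec_norm2 (perp z))) - ?c = (1 - ?c) * prob {0\<^sub>v d}"
    by simp
  have "cmod (1 - ?c) = \<bar>1 - exp (- (t\<^sup>2) / 2)\<bar>"
    by (metis norm_of_real of_real_1 of_real_diff)
  also have "\<dots> \<le> 1" by simp
  finally have "cmod ((1 - ?c) * prob {0\<^sub>v d}) \<le> 1 * prob {0\<^sub>v d}"
    unfolding norm_mult by (intro mult_mono) auto
  then show ?E using eq by simp
qed

text \<open>Exchanging the length of \<open>b\<close> for the random length of \<open>perp z\<close>
  costs a Lipschitz constant times the mean difference of the lengths. For
  \<open>b \<bullet> b\<close> near \<open>d\<close> this difference is merely bounded, so a
  Lipschitz constant of order \<open>1\<close> would not do. The second moment \<open>q\<close> of a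
  unit component improves it to \<open>\<bar>t\<bar> / sqrt (real d - 1)\<close>.\<close>

lemma char_component_bound:
  assumes b: "b \<in> carrier_vec d" "b \<bullet> \<theta> = 0" "b \<noteq> 0\<^sub>v d" and d: "2 \<le> d"
  shows "cmod (char (distr N borel (vec_component b)) t - char std_normal_distribution t)
    \<le> prob {0\<^sub>v d} + \<bar>t\<bar> * ((\<bar>real d - b \<bullet> b\<bar> + sqrt (2 * real d) + 1) / (vec_norm2 b * sqrt (real d - 1)))"
proof -
  let ?G = "std_normal_vec d"
  interpret G: prob_space ?G by (rule prob_space_std_normal_vec)
  define S where "S = vec_norm2 b"
  have S: "0 < S"
    using vec_norm2_eq_0[OF b(1)] b(3) vec_norm2_nonneg[of b] by (simp add: S_def)
  have S2: "b \<bullet> b = S\<^sup>2" by (simp add: S_def vec_norm2_power2)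
  define e where "e = (1 / S) \<cdot>\<^sub>v b"
  have e: "e \<in> carrier_vec d" "e \<bullet> \<theta> = 0" "e \<bullet> e = 1"
    using b axis S normalized_scalar_prod[OF b(1,3)] unfolding e_def S_def by auto
  have be: "b = S \<cdot>\<^sub>v e" using S b by (simp add: e_def smult_smult_assoc)
  define \<phi> where "\<phi> = (\<lambda>s. (CLINT v|N. iexp (s * vec_component e v)))"
  note em [measurable] = component_measurable[OF e(1)]
  define q where "q = expectation (\<lambda>v. (vec_component e v)\<^sup>2)"
  have q0: "0 \<le> q" by (simp add: q_def)
  have "q \<le> 1 / (real d - 1)"
    using component_second_moment_le[OF e] d by (simp add: q_def field_simps)
  then have sq: "sqrt q \<le> 1 / sqrt (real d - 1)"
    using real_sqrt_le_mono real_sqrt_divide real_sqrt_one by metis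
  have i2: "integrable N (\<lambda>v. (vec_component e v)\<^sup>2)"
    by (rule integrable_component_power2[OF e(1)])
  have lip: "cmod (\<phi> s - \<phi> s') \<le> \<bar>s - s'\<bar> * sqrt q" for s s'
  proof -
    have int: "integrable N (\<lambda>v. iexp (s * vec_component e v))" for s
      by (rule integrable_const_bound[where B=1]) auto
    have abs: "integrable N (\<lambda>v. \<bar>vec_component e v\<bar>)"
      using expectation_abs_le_sqrt(1)[OF em i2] by simp
    have "cmod (\<phi> s - \<phi> s') = cmod (CLINT v|N. iexp (s * vec_component e v) - iexp (s' * vec_component e v))"
      using int by (simp add: \<phi>_def)
    also have "\<dots> \<le> (LINT v|N. cmod (iexp (s * vec_component e v) - iexp (s' * vec_component e v)))"
      by (rule integral_norm_bound)
    also have "\<dots> \<le> (LINT v|N. \<bar>s - s'\<bar> * \<bar>vec_component e v\<bar>)"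
    proof (rule integral_mono)
      show "cmod (iexp (s * vec_component e v) - iexp (s' * vec_component e v)) \<le> \<bar>s - s'\<bar> * \<bar>vec_component e v\<bar>" for v
        using cmod_iexp_diff_le[of "s * vec_component e v" "s' * vec_component e v"]
        by (simp add: left_diff_distrib[symmetric] abs_mult)
    qed (use int abs in auto)
    also have "\<dots> \<le> \<bar>s - s'\<bar> * sqrt q"
      using expectation_abs_le_sqrt(2)[OF em i2] by (simp add: q_def mult_left_mono)
    finally show ?thesis .
  qed
  have avg: "integrable ?G (\<lambda>z. \<phi> (t * vec_norm2 (perp z)))"
    "cmod ((CLINT z|?G. \<phi> (t * vec_norm2 (perp z))) - exp (- (t\<^sup>2) / 2)) \<le> prob {0\<^sub>v d}"
    unfolding \<phi>_def by (fact gaussian_average_iexp_component[OF e, of t])+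
  have char: "char (distr N borel (vec_component b)) t = \<phi> (t * S)"
  proof -
    have "char (distr N borel (vec_component b)) t = (CLINT v|N. iexp (t * vec_component b v))"
      unfolding char_def using component_measurable[OF b(1)] by (subst integral_distr) auto
    also have "\<dots> = \<phi> (t * S)"
      unfolding \<phi>_def
      by (subst be, intro Bochner_Integration.integral_cong refl)
         (use e in \<open>simp add: vec_component_smult[of _ d] space_N mult.assoc\<close>)
    finally show ?thesis .
  qed
  have pp: "(\<lambda>z. perp z \<bullet> perp z) \<in> borel_measurable ?G"
    using perp_moments(1) by (rule borel_measurable_integrable)
  have ppi: "integrable ?G (\<lambda>z. \<bar>perp z \<bullet> perp z - S\<^sup>2\<bar>)"
    using perp_moments(1) by simp
  have "cmod (\<phi> (t * S) - (CLINT z|?G. \<phi> (t * vec_norm2 (perp z))))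
      = cmod (CLINT z|?G. \<phi> (t * S) - \<phi> (t * vec_norm2 (perp z)))"
    using avg(1) G.prob_space by simp
  also have "\<dots> \<le> (LINT z|?G. cmod (\<phi> (t * S) - \<phi> (t * vec_norm2 (perp z))))"
    by (rule integral_norm_bound)
  also have "\<dots> \<le> (LINT z|?G. \<bar>t\<bar> * sqrt q / S * \<bar>perp z \<bullet> perp z - S\<^sup>2\<bar>)"
  proof (rule integral_mono)
    fix z
    let ?n = "vec_norm2 (perp z)"
    have n: "0 \<le> ?n" by (rule vec_norm2_nonneg)
    \<comment> \<open>The moment bound concerns squared lengths. Dividing by \<open>S + ?n\<close>,
      which is at least \<open>S\<close>, returns to lengths without any lower bound on the random
      one.\<close>
    have "\<bar>perp z \<bullet> perp z - S\<^sup>2\<bar> = \<bar>S - ?n\<bar> * (S + ?n)"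
    proof -
      have "perp z \<bullet> perp z - S\<^sup>2 = (?n - S) * (S + ?n)"
        unfolding vec_norm2_power2[of "perp z", symmetric] by (simp add: power2_eq_square algebra_simps)
      then show ?thesis
        using S n by (simp add: abs_mult abs_minus_commute)
    qed
    then have "\<bar>S - ?n\<bar> * S \<le> \<bar>perp z \<bullet> perp z - S\<^sup>2\<bar>"
      using n by (simp add: mult_left_mono)
    then have "\<bar>S - ?n\<bar> \<le> \<bar>perp z \<bullet> perp z - S\<^sup>2\<bar> / S"
      using S by (simp add: pos_le_divide_eq)
    then have "\<bar>t\<bar> * sqrt q * \<bar>S - ?n\<bar> \<le> \<bar>t\<bar> * sqrt q * (\<bar>perp z \<bullet> perp z - S\<^sup>2\<bar> / S)"
      using q0 by (intro mult_left_mono) auto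
    moreover have "cmod (\<phi> (t * S) - \<phi> (t * ?n)) \<le> \<bar>t\<bar> * sqrt q * \<bar>S - ?n\<bar>"
    proof -
      have "\<bar>t * S - t * ?n\<bar> = \<bar>t\<bar> * \<bar>S - ?n\<bar>"
        by (simp add: right_diff_distrib[symmetric] abs_mult)
      then show ?thesis
        using lip[of "t * S" "t * ?n"] by (simp only: mult_ac)
    qed
    ultimately show "cmod (\<phi> (t * S) - \<phi> (t * ?n)) \<le> \<bar>t\<bar> * sqrt q / S * \<bar>perp z \<bullet> perp z - S\<^sup>2\<bar>"
      by simp
  qed (use avg(1) ppi in auto)
  also have "\<dots> = \<bar>t\<bar> * sqrt q / S * (LINT z|?G. \<bar>perp z \<bullet> perp z - S\<^sup>2\<bar>)"
    by simp
  also have "\<dots> \<le> \<bar>t\<bar> * (1 / sqrt (real d - 1)) / S * (\<bar>real d - S\<^sup>2\<bar> + sqrt (2 * real d) + 1)"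
    using S sq q0 d by (intro mult_mono divide_right_mono perp_moments(3)) auto
  also have "\<dots> = \<bar>t\<bar> * ((\<bar>real d - b \<bullet> b\<bar> + sqrt (2 * real d) + 1) / (vec_norm2 b * sqrt (real d - 1)))"
    unfolding S2 S_def[symmetric] by simp
  finally have 1: "cmod (\<phi> (t * S) - (CLINT z|?G. \<phi> (t * vec_norm2 (perp z)))) \<le> \<dots>" .
  have "cmod (\<phi> (t * S) - exp (- (t\<^sup>2) / 2)) \<le> cmod (\<phi> (t * S) - (CLINT z|?G. \<phi> (t * vec_norm2 (perp z))))
      + cmod ((CLINT z|?G. \<phi> (t * vec_norm2 (perp z))) - exp (- (t\<^sup>2) / 2))"
    by (rule norm_triangle_ineq[THEN order_trans[rotated]]) simp
  then show ?thesis
    using 1 avg(2) by (simp add: char char_std_normal_distribution)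
qed

end

section \<open>Equivariance of the minimizer\<close>

text \<open>A singular matrix has the eigenvalue \<open>0\<close>, which would force the minimum of
  the finite spectrum down to \<open>0\<close>.\<close>

lemma mat_inverse_of_Min_spectrum_pos:
  fixes S :: "real mat"
  assumes S: "S \<in> carrier_mat d d" and pos: "0 < Min (spectrum S)"
  obtains B where "mat_inverse S = Some B" "B \<in> carrier_mat d d" "S * B = 1\<^sub>m d" "B * S = 1\<^sub>m d"
proof (cases "mat_inverse S")
  case None
  then have "S \<notin> Units (ring_mat TYPE(real) d ())"
    by (rule mat_inverse(1)[OF S])
  then have "det S = 0"
    using det_non_zero_imp_unit[OF S, where b="()"] by blast
  then obtain v where "v \<in> carrier_vec d" "v \<noteq> 0\<^sub>v d" "S *\<^sub>v v = 0\<^sub>v d"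
    using det_0_iff_vec_prod_zero_field[OF S] by blast
  then have "eigenvector S v 0"
    using S by (auto simp: eigenvector_def)
  then have "0 \<in> spectrum S"
    by (auto simp: spectrum_def eigenvalue_def)
  then have "Min (spectrum S) \<le> 0"
    using card_finite_spectrum(1)[OF S] by simp
  then show ?thesis using pos by simp
next
  case (Some B)
  then show ?thesis
    using that mat_inverse(2)[OF S Some] by blast
qed

lemma transpose_mult_vec_scalar_prod:
  fixes A :: "real mat"
  assumes "A \<in> carrier_mat d d" "x \<in> carrier_vec d" "y \<in> carrier_vec d"
  shows "x \<bullet> (A *\<^sub>v y) = (transpose_mat A *\<^sub>v x) \<bullet> y"
  using transpose_vec_mult_scalar[OF assms(1,3,2)] assms
  by (metis comm_scalar_prod mult_mat_vec_carrier transpose_carrier_mat)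

section \<open>The law of one observation and the transport of minimizers\<close>

lemma distr_indep_pair:
  assumes "prob_space M" and ind: "indep_pair M N X K Z"
  shows "distr M (N \<Otimes>\<^sub>M K) (\<lambda>w. (X w, Z w)) = distr M N X \<Otimes>\<^sub>M distr M K Z"
proof -
  interpret prob_space M by fact
  have [measurable]: "X \<in> measurable M N" "Z \<in> measurable M K"
    using ind by (auto simp: indep_pair_def)
  interpret X: prob_space "distr M N X" by (rule prob_space_distr) measurable
  interpret Z: prob_space "distr M K Z" by (rule prob_space_distr) measurable
  show ?thesis
  proof (rule pair_measure_eqI[symmetric])
    fix A B assume A: "A \<in> sets (distr M N X)" and B: "B \<in> sets (distr M K Z)"
    have "prob ((X -` A \<inter> space M) \<inter> (Z -` B \<inter> space M)) = prob (X -` A \<inter> space M) * prob (Z -` B \<inter> space M)"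
      using ind A B unfolding indep_pair_def by (intro indep_setD) auto
    moreover have "(\<lambda>w. (X w, Z w)) -` (A \<times> B) \<inter> space M = (X -` A \<inter> space M) \<inter> (Z -` B \<inter> space M)"
      by auto
    ultimately show "emeasure (distr M N X) A * emeasure (distr M K Z) B
        = emeasure (distr M (N \<Otimes>\<^sub>M K) (\<lambda>w. (X w, Z w))) (A \<times> B)"
      using A B by (simp add: emeasure_distr emeasure_eq_measure ennreal_mult[symmetric])
  qed (auto intro: X.sigma_finite_measure_axioms Z.sigma_finite_measure_axioms)
qed

lemma measurable_response:
  assumes b: "b \<in> carrier_vec d"
    and F: "case_prod F \<in> measurable (borel \<Otimes>\<^sub>M borel) (restrict_space borel Y)"
  shows "(\<lambda>(x, u). (x, F (b \<bullet> x) u)) \<in> measurable (borel_vec d \<Otimes>\<^sub>M borel) (obs_space d Y)"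
proof -
  have bx: "(\<lambda>p. b \<bullet> fst p) \<in> borel_measurable (borel_vec d \<Otimes>\<^sub>M borel)"
    using b by (intro borel_measurable_scalar_prod[where d=d]) auto
  have "(\<lambda>p. case_prod F (b \<bullet> fst p, snd p)) \<in> measurable (borel_vec d \<Otimes>\<^sub>M borel) (restrict_space borel Y)"
    by (rule measurable_compose[OF _ F]) (use bx in measurable)
  then show ?thesis
    unfolding obs_space_def split_beta by (intro measurable_Pair) auto
qed

text \<open>As \<open>K\<close> preserves \<open>b \<bullet> x\<close>, it preserves the response,
  so it may be applied before or after the response is formed. Before, it acts only on the first
  factor of a product measure, where it is harmless.\<close>

lemma pair_law_invariant:
  assumes N: "prob_space N" "sets N = sets (borel_vec d)" and \<mu>: "prob_space \<mu>" "sets \<mu> = sets (borel :: real measure)"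
    and K: "K \<in> measurable (borel_vec d) (borel_vec d)" "distr N (borel_vec d) K = N"
    and b: "b \<in> carrier_vec d" "\<And>x. x \<in> carrier_vec d \<Longrightarrow> b \<bullet> K x = b \<bullet> x"
    and F: "case_prod F \<in> measurable (borel \<Otimes>\<^sub>M borel) (restrict_space borel Y)"
  defines "P \<equiv> distr (N \<Otimes>\<^sub>M \<mu>) (obs_space d Y) (\<lambda>(x, u). (x, F (b \<bullet> x) u))"
  shows "distr P (obs_space d Y) (\<lambda>(x, r). (K x, r)) = P"
proof -
  interpret N: prob_space N by fact
  interpret \<mu>: prob_space \<mu> by fact
  let ?h = "\<lambda>(x, u). (x, F (b \<bullet> x) u)"
  have spN: "space N = carrier_vec d" using sets_eq_imp_space_eq[OF N(2)] by simp
  have sets: "sets (N \<Otimes>\<^sub>M \<mu>) = sets (borel_vec d \<Otimes>\<^sub>M borel)"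
    by (rule sets_pair_measure_cong[OF N(2) \<mu>(2)])
  have h: "?h \<in> measurable (borel_vec d \<Otimes>\<^sub>M borel) (obs_space d Y)"
    by (rule measurable_response[OF b(1) F])
  then have h': "?h \<in> measurable (N \<Otimes>\<^sub>M \<mu>) (obs_space d Y)"
    by (simp cong: measurable_cong_sets add: sets)
  have k: "(\<lambda>(x, r). (K x, r)) \<in> measurable (obs_space d Y) (obs_space d Y)"
    unfolding obs_space_def split_beta using K(1) by (intro measurable_Pair measurable_compose[OF measurable_fst]) auto
  have k': "(\<lambda>(x, u). (K x, u)) \<in> measurable (N \<Otimes>\<^sub>M \<mu>) (borel_vec d \<Otimes>\<^sub>M borel)"
    unfolding split_beta using K(1)
    by (intro measurable_Pair measurable_compose[OF measurable_fst])
       (simp_all cong: measurable_cong_sets add: N(2) \<mu>(2) sets)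
  have KN: "K \<in> measurable N (borel_vec d)"
    using K(1) by (simp cong: measurable_cong_sets add: N(2))
  have "distr P (obs_space d Y) (\<lambda>(x, r). (K x, r)) = distr (N \<Otimes>\<^sub>M \<mu>) (obs_space d Y) (\<lambda>p. (\<lambda>(x, r). (K x, r)) (?h p))"
    unfolding P_def by (subst distr_distr[OF k h']) (simp add: comp_def)
  also have "\<dots> = distr (N \<Otimes>\<^sub>M \<mu>) (obs_space d Y) (\<lambda>p. ?h ((\<lambda>(x, u). (K x, u)) p))"
    by (intro distr_cong) (auto simp: space_pair_measure spN b(2))
  also have "\<dots> = distr (distr (N \<Otimes>\<^sub>M \<mu>) (borel_vec d \<Otimes>\<^sub>M borel) (\<lambda>(x, u). (K x, u))) (obs_space d Y) ?h"
    by (subst distr_distr[OF h k']) (simp add: comp_def)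
  also have "distr (N \<Otimes>\<^sub>M \<mu>) (borel_vec d \<Otimes>\<^sub>M borel) (\<lambda>(x, u). (K x, u)) = distr N (borel_vec d) K \<Otimes>\<^sub>M distr \<mu> borel (\<lambda>u. u)"
    by (rule pair_measure_distr[OF KN, symmetric])
       (simp_all cong: measurable_cong_sets add: \<mu>(2) \<mu>.sigma_finite_measure_axioms distr_id2)
  also have "\<dots> = N \<Otimes>\<^sub>M \<mu>"
    by (simp add: K(2) \<mu>(2) distr_id2)
  finally show ?thesis unfolding P_def .
qed

text \<open>The involution carries a minimizer of \<open>g\<close> to a minimizer of
  \<open>f\<close>; uniqueness then identifies it with the given one.\<close>

lemma is_arg_min_image:
  assumes conj: "\<And>b. b \<in> C \<Longrightarrow> g b = f (T b)" and T: "\<And>b. b \<in> C \<Longrightarrow> T b \<in> C" "\<And>b. b \<in> C \<Longrightarrow> T (T b) = b"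
    and f: "{b. is_arg_min f (\<lambda>b. b \<in> C) b} = {x}" and g: "{b. is_arg_min g (\<lambda>b. b \<in> C) b} = {y}"
  shows "y = T x"
proof -
  have y: "y \<in> C" "\<And>b. b \<in> C \<Longrightarrow> \<not> g b < g y"
    using g by (auto simp: is_arg_min_def set_eq_iff)
  have "is_arg_min f (\<lambda>b. b \<in> C) (T y)"
    unfolding is_arg_min_def
  proof (intro conjI notI)
    assume "\<exists>b. b \<in> C \<and> f b < f (T y)"
    then obtain b where b: "b \<in> C" "f b < f (T y)" by blast
    have "g (T b) < g y"
      using b y(1) by (simp add: conj T)
    then show False using y(2)[of "T b"] b(1) T by blast
  qed (use T y in auto)
  then have "T y = x" using f by blast
  then show ?thesis using T(2)[OF y(1)] by simp
qed

section \<open>Whitened coordinates\<close>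

text \<open>\<open>A\<close> may be any factor of the covariance and need not be symmetric, so
  transposes are tracked throughout. The assumption \<open>inverse\<close> ties the inverse
  occurring in \<open>tau_coef\<close> to \<open>Ai\<close>.\<close>

locale whitening =
  fixes d :: nat and A Ai :: "real mat" and \<beta> :: "real vec"
  assumes A: "A \<in> carrier_mat d d" and Ai: "Ai \<in> carrier_mat d d"
    and A_Ai: "A * Ai = 1\<^sub>m d" and Ai_A: "Ai * A = 1\<^sub>m d"
    and \<beta>: "\<beta> \<in> carrier_vec d" and \<beta>_unit: "\<beta> \<bullet> ((A * transpose_mat A) *\<^sub>v \<beta>) = 1"
    and inverse: "mat_inverse (A * transpose_mat A) = Some (transpose_mat Ai * Ai)"
begin

definition \<theta> :: "real vec" where "\<theta> = transpose_mat A *\<^sub>v \<beta>"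

definition rot_X :: "real vec \<Rightarrow> real vec \<Rightarrow> real vec" where
  "rot_X w x = A *\<^sub>v reflect w (Ai *\<^sub>v x)"

text \<open>The adjoint of \<open>rot_X w\<close>: rotating all covariates affects the loss like
  rotating the coefficients. Covariates are whitened by \<open>Ai\<close>, coefficients dually by
  the transpose of \<open>A\<close>.\<close>

definition rot_b :: "real vec \<Rightarrow> real vec \<Rightarrow> real vec" where
  "rot_b w b = transpose_mat Ai *\<^sub>v reflect w (transpose_mat A *\<^sub>v b)"

definition residual :: "real vec \<Rightarrow> real vec" where
  "residual b = transpose_mat A *\<^sub>v (b - mu_coef (A * transpose_mat A) \<beta> b \<cdot>\<^sub>v \<beta>)"

lemma At: "transpose_mat A \<in> carrier_mat d d" and Ait: "transpose_mat Ai \<in> carrier_mat d d"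
  using A Ai by auto

lemma At_Ait: "transpose_mat A * transpose_mat Ai = 1\<^sub>m d" and Ait_At: "transpose_mat Ai * transpose_mat A = 1\<^sub>m d"
  unfolding transpose_mult[OF Ai A, symmetric] transpose_mult[OF A Ai, symmetric] A_Ai Ai_A by simp_all

lemma cancel:
  assumes "x \<in> carrier_vec d"
  shows "A *\<^sub>v (Ai *\<^sub>v x) = x" "Ai *\<^sub>v (A *\<^sub>v x) = x"
    "transpose_mat A *\<^sub>v (transpose_mat Ai *\<^sub>v x) = x" "transpose_mat Ai *\<^sub>v (transpose_mat A *\<^sub>v x) = x"
  using assms A_Ai Ai_A At_Ait Ait_At
    assoc_mult_mat_vec[OF A Ai assms] assoc_mult_mat_vec[OF Ai A assms]
    assoc_mult_mat_vec[OF At Ait assms] assoc_mult_mat_vec[OF Ait At assms] by simp_all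

lemma mult_carrier:
  assumes "x \<in> carrier_vec d"
  shows "A *\<^sub>v x \<in> carrier_vec d" "Ai *\<^sub>v x \<in> carrier_vec d"
    "transpose_mat A *\<^sub>v x \<in> carrier_vec d" "transpose_mat Ai *\<^sub>v x \<in> carrier_vec d"
  using assms A Ai At Ait mult_mat_vec_carrier by blast+

lemma \<theta>: "\<theta> \<in> carrier_vec d"
  unfolding \<theta>_def by (rule mult_carrier(3)[OF \<beta>])

lemma form_eq:
  assumes "x \<in> carrier_vec d" "y \<in> carrier_vec d"
  shows "x \<bullet> ((A * transpose_mat A) *\<^sub>v y) = (transpose_mat A *\<^sub>v x) \<bullet> (transpose_mat A *\<^sub>v y)"
  using transpose_mult_vec_scalar_prod[OF A assms(1) mult_carrier(3)[OF assms(2)]]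
    assoc_mult_mat_vec[OF A At assms(2)] by simp

lemma \<theta>_unit: "\<theta> \<bullet> \<theta> = 1"
  using \<beta>_unit form_eq[OF \<beta> \<beta>] by (simp add: \<theta>_def)

lemma rot_b_adjoint:
  assumes "w \<in> carrier_vec d" "b \<in> carrier_vec d" "x \<in> carrier_vec d"
  shows "b \<bullet> rot_X w x = rot_b w b \<bullet> x"
proof -
  note c = mult_carrier reflect_carrier[OF assms(1)]
  have "b \<bullet> rot_X w x = (transpose_mat A *\<^sub>v b) \<bullet> reflect w (Ai *\<^sub>v x)"
    unfolding rot_X_def using assms by (intro transpose_mult_vec_scalar_prod[OF A] c)
  also have "\<dots> = reflect w (transpose_mat A *\<^sub>v b) \<bullet> (Ai *\<^sub>v x)"
    using assms by (intro reflect_self_adjoint[OF assms(1), symmetric] c)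
  also have "\<dots> = rot_b w b \<bullet> x"
    unfolding rot_b_def using assms by (intro transpose_mult_vec_scalar_prod[OF Ai] c)
  finally show ?thesis .
qed

lemma rot_b_carrier: "w \<in> carrier_vec d \<Longrightarrow> b \<in> carrier_vec d \<Longrightarrow> rot_b w b \<in> carrier_vec d"
  unfolding rot_b_def by (intro mult_carrier reflect_carrier)

lemma transpose_rot_b:
  "w \<in> carrier_vec d \<Longrightarrow> b \<in> carrier_vec d \<Longrightarrow> transpose_mat A *\<^sub>v rot_b w b = reflect w (transpose_mat A *\<^sub>v b)"
  unfolding rot_b_def by (intro cancel reflect_carrier mult_carrier)

lemma rot_b_involution: "w \<in> carrier_vec d \<Longrightarrow> b \<in> carrier_vec d \<Longrightarrow> rot_b w (rot_b w b) = b"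
  using transpose_rot_b[of w b]
  by (simp add: rot_b_def[of w "rot_b w b"] reflect_involution[of w d] mult_carrier cancel)

lemma rot_b_\<beta>: "w \<in> carrier_vec d \<Longrightarrow> w \<bullet> \<theta> = 0 \<Longrightarrow> rot_b w \<beta> = \<beta>"
  using \<theta> \<beta> by (simp add: rot_b_def \<theta>_def[symmetric] reflect_orthogonal) (simp add: \<theta>_def cancel)

lemma measurable_rot_X: "w \<in> carrier_vec d \<Longrightarrow> rot_X w \<in> measurable (borel_vec d) (borel_vec d)"
  unfolding rot_X_def[abs_def]
  by (intro borel_vec_measurable_mult_mat[OF A] measurable_compose[OF _ measurable_reflect]
      borel_vec_measurable_mult_mat[OF Ai] measurable_borel_vec_id)

text \<open>In terms of the underlying standard normal vector, \<open>rot_X w\<close> is a plain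
  reflection.\<close>

lemma normal_law_rot_X:
  assumes w: "w \<in> carrier_vec d"
  defines "N \<equiv> distr (std_normal_vec d) (borel_vec d) (\<lambda>z. A *\<^sub>v z)"
  shows "distr N (borel_vec d) (rot_X w) = N"
proof -
  let ?G = "std_normal_vec d"
  have a: "(\<lambda>z. A *\<^sub>v z) \<in> measurable (borel_vec d) (borel_vec d)"
    by (intro borel_vec_measurable_mult_mat[OF A] measurable_borel_vec_id)
  have r: "reflect w \<in> measurable ?G (borel_vec d)"
    using measurable_reflect[OF w] by simp
  have "distr N (borel_vec d) (rot_X w) = distr ?G (borel_vec d) (\<lambda>z. rot_X w (A *\<^sub>v z))"
    unfolding N_def using a by (subst distr_distr[OF measurable_rot_X[OF w]]) (simp_all add: comp_def)
  also have "\<dots> = distr ?G (borel_vec d) (\<lambda>z. A *\<^sub>v reflect w z)"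
    by (intro distr_cong) (auto simp: rot_X_def cancel)
  also have "\<dots> = distr (distr ?G (borel_vec d) (reflect w)) (borel_vec d) (\<lambda>z. A *\<^sub>v z)"
    by (subst distr_distr[OF a r]) (simp add: comp_def)
  also have "\<dots> = N"
    by (simp add: distr_std_normal_vec_reflect[OF w] N_def)
  finally show ?thesis .
qed

lemma mu_coef_eq: "b \<in> carrier_vec d \<Longrightarrow> mu_coef (A * transpose_mat A) \<beta> b = (transpose_mat A *\<^sub>v b) \<bullet> \<theta>"
  using \<beta> \<beta>_unit form_eq[of b \<beta>] by (simp add: mu_coef_def \<theta>_def)

lemma residual_eq:
  assumes b: "b \<in> carrier_vec d"
  shows "residual b = transpose_mat A *\<^sub>v b - ((transpose_mat A *\<^sub>v b) \<bullet> \<theta>) \<cdot>\<^sub>v \<theta>"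
  unfolding residual_def mu_coef_eq[OF b] \<theta>_def using b \<beta> At
  by (subst mult_minus_distrib_mat_vec[OF At]) (simp_all add: mult_mat_vec[OF At])

lemma residual_carrier: "b \<in> carrier_vec d \<Longrightarrow> residual b \<in> carrier_vec d"
  using \<theta> by (simp add: residual_eq mult_carrier)

lemma residual_\<theta>: "b \<in> carrier_vec d \<Longrightarrow> \<theta> \<bullet> residual b = 0"
  using \<theta> \<theta>_unit mult_carrier(3)[of b]
  by (simp add: residual_eq scalar_prod_minus_distrib[of _ d] comm_scalar_prod[of \<theta> d "transpose_mat A *\<^sub>v b"])

text \<open>As \<open>w\<close> is orthogonal to \<open>\<theta>\<close>, the reflection fixes the
  part along \<open>\<theta>\<close> and commutes with its removal.\<close>

lemma residual_rot_b:
  assumes w: "w \<in> carrier_vec d" "w \<bullet> \<theta> = 0" and b: "b \<in> carrier_vec d"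
  shows "residual (rot_b w b) = reflect w (residual b)"
proof -
  define x where "x = transpose_mat A *\<^sub>v b"
  have x: "x \<in> carrier_vec d" using b by (simp add: x_def mult_carrier)
  have "reflect w x \<bullet> \<theta> = x \<bullet> \<theta>"
    using reflect_self_adjoint[OF w(1) x \<theta>] reflect_orthogonal[OF w(1) \<theta> w(2)] by simp
  then have "residual (rot_b w b) = reflect w x - (x \<bullet> \<theta>) \<cdot>\<^sub>v \<theta>"
    using w b by (simp add: residual_eq rot_b_carrier transpose_rot_b x_def)
  moreover have "w \<bullet> (x - (x \<bullet> \<theta>) \<cdot>\<^sub>v \<theta>) = w \<bullet> x"
    using w x \<theta> by (simp add: scalar_prod_minus_distrib[of _ d])
  then have "reflect w (x - (x \<bullet> \<theta>) \<cdot>\<^sub>v \<theta>) = reflect w x - (x \<bullet> \<theta>) \<cdot>\<^sub>v \<theta>"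
    using w x \<theta> by (auto simp: reflect_def intro!: eq_vecI)
  ultimately show ?thesis by (simp add: residual_eq[OF b] x_def)
qed

lemma measurable_residual: "residual \<in> measurable (borel_vec d) (borel_vec d)"
proof -
  have [measurable]: "(\<lambda>b. b \<bullet> ((A * transpose_mat A) *\<^sub>v \<beta>)) \<in> borel_measurable (borel_vec d)"
    using A At \<beta> by (intro borel_measurable_scalar_prod[where d=d] borel_vec_measurable_const
        mult_mat_vec_carrier measurable_borel_vec_id) auto
  show ?thesis
    unfolding residual_def[abs_def] mu_coef_def
    by (intro borel_vec_measurable_mult_mat[OF At] borel_vec_measurable_diff borel_vec_measurable_smult
        borel_vec_measurable_const measurable_borel_vec_id \<beta>) measurable
qed

lemma sigma_coef_eq: "b \<in> carrier_vec d \<Longrightarrow> sigma_coef (A * transpose_mat A) \<beta> b = vec_norm2 (residual b)"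
  using \<beta> by (simp add: sigma_coef_def norm_wrt_def vec_norm2_def form_eq residual_def)

text \<open>Coordinate \<open>j\<close> of a vector is the inner product of \<open>col Ai j\<close>
  with its whitened image, and the squared length of this column is the diagonal entry of the
  inverse covariance. Hence \<open>tau_coef\<close> is exactly the factor that normalizes the
  column.\<close>

definition direction :: "nat \<Rightarrow> real vec" where
  "direction j = tau_coef (A * transpose_mat A) j \<cdot>\<^sub>v col Ai j"

lemma
  assumes j: "j < d"
  shows direction_carrier: "direction j \<in> carrier_vec d"
    and direction_unit: "direction j \<bullet> direction j = 1"
    and direction_\<theta>: "direction j \<bullet> \<theta> = tau_coef (A * transpose_mat A) j * \<beta> $ j"
    and T_stat_eq: "b \<in> carrier_vec d \<Longrightarrow>
      T_stat (A * transpose_mat A) \<beta> b j = sqrt (real d) * vec_component (direction j) (residual b)"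
proof -
  let ?t = "tau_coef (A * transpose_mat A) j"
  have c: "col Ai j \<in> carrier_vec d" using Ai j by auto
  have B: "(transpose_mat Ai * Ai) $$ (j, j) = col Ai j \<bullet> col Ai j"
    using Ai j by simp
  have comp: "(transpose_mat Ai *\<^sub>v x) $ j = col Ai j \<bullet> x" if "x \<in> carrier_vec d" for x
    using Ai j that by simp
  have "col Ai j \<bullet> col Ai j \<noteq> 0"
  proof
    assume "col Ai j \<bullet> col Ai j = 0"
    then have "col Ai j = 0\<^sub>v d" using scalar_prod_self_eq_0[OF c] by simp
    then have "(A * Ai) $$ (j, j) = 0" using A Ai j by simp
    then show False using j by (simp add: A_Ai)
  qed
  then have pos: "0 < col Ai j \<bullet> col Ai j"
    using scalar_prod_self_nonneg[of "col Ai j"] by simp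
  have t: "?t = sqrt (1 / (col Ai j \<bullet> col Ai j))"
    by (simp only: tau_coef_def inverse option.sel B)
  have tt: "?t * (?t * (col Ai j \<bullet> col Ai j)) = 1"
    using pos unfolding t mult.assoc[symmetric] by simp
  show u: "direction j \<in> carrier_vec d" using c by (simp add: direction_def)
  show "direction j \<bullet> direction j = 1" using c tt by (simp add: direction_def)
  show "direction j \<bullet> \<theta> = ?t * \<beta> $ j"
    using c \<theta> comp[OF \<theta>] \<beta> by (simp add: direction_def) (simp add: \<theta>_def cancel)
  assume b: "b \<in> carrier_vec d"
  let ?m = "mu_coef (A * transpose_mat A) \<beta> b"
  have "b $ j - ?m * \<beta> $ j = (b - ?m \<cdot>\<^sub>v \<beta>) $ j"
    using b \<beta> j by simp
  also have "b - ?m \<cdot>\<^sub>v \<beta> = transpose_mat Ai *\<^sub>v residual b"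
    using b \<beta> by (simp add: residual_def cancel)
  also have "(transpose_mat Ai *\<^sub>v residual b) $ j = col Ai j \<bullet> residual b"
    by (rule comp[OF residual_carrier[OF b]])
  finally have "b $ j - ?m * \<beta> $ j = col Ai j \<bullet> residual b" .
  then show "T_stat (A * transpose_mat A) \<beta> b j = sqrt (real d) * vec_component (direction j) (residual b)"
    using \<beta> c residual_carrier[OF b]
    by (simp add: T_stat_def sigma_coef_eq[OF b] vec_component_def direction_def)
qed

end

section \<open>The law of the sample and measurability of the statistic\<close>

lemma sample_law_invariant:
  assumes "finite I" and P: "prob_space P" "sets P = sets K" and k: "k \<in> measurable K K" "distr P K k = P"
  shows "distr (\<Pi>\<^sub>M i\<in>I. P) (\<Pi>\<^sub>M i\<in>I. K) (\<lambda>s. \<lambda>i\<in>I. k (s i)) = (\<Pi>\<^sub>M i\<in>I. P)"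
proof -
  have "k \<in> measurable P P"
    using k(1) by (simp cong: measurable_cong_sets add: P(2))
  then have "distr (\<Pi>\<^sub>M i\<in>I. P) (\<Pi>\<^sub>M i\<in>I. P) (compose I k) = (\<Pi>\<^sub>M i\<in>I. distr P P k)"
    using P assms(1) by (intro distr_PiM_finite_prob_space') auto
  also have "distr P P k = distr P K k"
    using P(2) by (intro distr_cong) auto
  also have "distr (\<Pi>\<^sub>M i\<in>I. P) (\<Pi>\<^sub>M i\<in>I. P) (compose I k) = distr (\<Pi>\<^sub>M i\<in>I. P) (\<Pi>\<^sub>M i\<in>I. K) (\<lambda>s. \<lambda>i\<in>I. k (s i))"
    using P(2) by (intro distr_cong sets_PiM_cong) (auto simp: compose_def)
  finally show ?thesis using k(2) by simp
qed

lemma measurable_norm_wrt: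
  assumes "S \<in> carrier_mat d d" "f \<in> measurable M (borel_vec d)"
  shows "(\<lambda>w. norm_wrt S (f w)) \<in> borel_measurable M"
proof -
  have [measurable]: "(\<lambda>w. f w \<bullet> (S *\<^sub>v f w)) \<in> borel_measurable M"
    by (intro borel_measurable_scalar_prod[where d=d] borel_vec_measurable_mult_mat[where e=d] assms)
  show ?thesis unfolding norm_wrt_def by measurable
qed

lemma measurable_mu_coef:
  assumes "S \<in> carrier_mat d d" "\<beta> \<in> carrier_vec d" "f \<in> measurable M (borel_vec d)"
  shows "(\<lambda>w. mu_coef S \<beta> (f w)) \<in> borel_measurable M"
proof -
  have [measurable]: "(\<lambda>w. f w \<bullet> (S *\<^sub>v \<beta>)) \<in> borel_measurable M"
    using assms by (intro borel_measurable_scalar_prod[where d=d] borel_vec_measurable_const mult_mat_vec_carrier)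
  show ?thesis unfolding mu_coef_def by measurable
qed

lemma measurable_sigma_coef:
  assumes "S \<in> carrier_mat d d" "\<beta> \<in> carrier_vec d" "f \<in> measurable M (borel_vec d)"
  shows "(\<lambda>w. sigma_coef S \<beta> (f w)) \<in> borel_measurable M"
  unfolding sigma_coef_def
  by (intro measurable_norm_wrt[where d=d] borel_vec_measurable_diff borel_vec_measurable_smult
      measurable_mu_coef[where d=d] borel_vec_measurable_const assms)

lemma measurable_T_stat:
  assumes "S \<in> carrier_mat d d" "\<beta> \<in> carrier_vec d" "f \<in> measurable M (borel_vec d)" "j < d"
  shows "(\<lambda>w. T_stat S \<beta> (f w) j) \<in> borel_measurable M"
proof -
  note [measurable] = measurable_sigma_coef[OF assms(1-3)] measurable_mu_coef[OF assms(1-3)]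
    measurable_vec_index[OF assms(3,4)]
  show ?thesis unfolding T_stat_def by measurable
qed

section \<open>The bound for a fixed sample size\<close>

text \<open>The quantity \<open>x\<close> measures how far the direction of coordinate
  \<open>j\<close> is from being orthogonal to the axis, scaled by \<open>sqrt (real d)\<close>;
  \<open>x\<^sup>2 < real d\<close> keeps its projection off the axis nonzero.\<close>

lemma char_T_stat_bound:
  fixes n d j :: nat and S :: "real mat" and \<beta> :: "real vec" and M :: "'w measure" and X :: "nat \<Rightarrow> 'w \<Rightarrow> real vec" and U y :: "nat \<Rightarrow> 'w \<Rightarrow> real"
  defines "D \<equiv> \<lambda>w. \<lambda>i\<in>{1..n}. (X i w, y i w)"
  assumes prob: "prob_space M" and n: "1 \<le> n"
    and S: "S \<in> carrier_mat d d" and \<beta>: "\<beta> \<in> carrier_vec d"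
    and F: "case_prod F \<in> measurable (borel \<Otimes>\<^sub>M borel) (restrict_space borel Y)"
    and X: "centered_normal_law d S (distr M (borel_vec d) (X 1))"
    and U: "indep_pair M (borel_vec d) (X 1) borel (U 1)"
    and y: "\<And>w. w \<in> space M \<Longrightarrow> y 1 w = F (\<beta> \<bullet> X 1 w) (U 1 w)"
    and indep: "prob_space.indep_vars M (\<lambda>_. obs_space d Y) (\<lambda>i w. (X i w, y i w)) {1..n}"
    and ident: "\<And>i. i \<in> {1..n} \<Longrightarrow> distr M (obs_space d Y) (\<lambda>w. (X i w, y i w)) =
      distr M (obs_space d Y) (\<lambda>w. (X 1 w, y 1 w))"
    and normalized: "\<beta> \<bullet> (S *\<^sub>v \<beta>) = 1"
    and spectrum: "0 < Min (spectrum S)"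
    and bbar: "bbar \<in> measurable (sample_space n d Y) (borel_vec d)"
    and argmin: "AE s in distr M (sample_space n d Y) D.
      {b. is_arg_min (total_loss l n s) (\<lambda>b. b \<in> carrier_vec d) b} = {bbar s}"
    and j: "j < d" and d: "2 \<le> d"
  defines "x \<equiv> sqrt (real d) * tau_coef S j * \<beta> $ j"
  assumes x: "x\<^sup>2 < real d"
  shows "cmod (char (distr M borel (\<lambda>w. T_stat S \<beta> (bbar (D w)) j)) t - char std_normal_distribution t)
    \<le> measure M {w \<in> space M. sigma_coef S \<beta> (bbar (D w)) = 0}
      + \<bar>t\<bar> * ((x\<^sup>2 + sqrt (2 * real d) + 1) / (sqrt (real d - x\<^sup>2) * sqrt (real d - 1)))"
proof -
  interpret M: prob_space M by fact
  let ?SS = "sample_space n d Y" and ?O = "obs_space d Y"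
  obtain A where A: "A \<in> carrier_mat d d" and AS: "A * transpose_mat A = S"
    and XA: "distr M (borel_vec d) (X 1) = distr (std_normal_vec d) (borel_vec d) (\<lambda>z. A *\<^sub>v z)"
    using X by (auto simp: centered_normal_law_def)
  obtain B where B: "mat_inverse S = Some B" "B \<in> carrier_mat d d" "S * B = 1\<^sub>m d"
    using mat_inverse_of_Min_spectrum_pos[OF S spectrum] by metis
  \<comment> \<open>By \<open>S = A * transpose_mat A\<close> and \<open>S * B = 1\<^sub>m d\<close>
    this is a right inverse of \<open>A\<close>, hence its inverse.\<close>
  define Ai where "Ai = transpose_mat A * B"
  have At: "transpose_mat A \<in> carrier_mat d d" using A by simp
  have Ai: "Ai \<in> carrier_mat d d" unfolding Ai_def by (rule mult_carrier_mat[OF At B(2)])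
  have A_Ai: "A * Ai = 1\<^sub>m d"
    unfolding Ai_def using assoc_mult_mat[OF A At B(2)] AS B(3) by simp
  have Ai_A: "Ai * A = 1\<^sub>m d" by (rule mat_mult_left_right_inverse[OF A Ai A_Ai])
  have Ait: "transpose_mat Ai \<in> carrier_mat d d" using Ai by simp
  have "transpose_mat Ai * transpose_mat A = 1\<^sub>m d"
    unfolding transpose_mult[OF A Ai, symmetric] A_Ai by simp
  then have BAi: "B = transpose_mat Ai * Ai"
    using assoc_mult_mat[OF Ait At B(2)] B(2) by (simp add: Ai_def)
  interpret W: whitening d A Ai \<beta>
    by unfold_locales (use A Ai A_Ai Ai_A \<beta> normalized B BAi AS in auto)
  note rv = indep[unfolded M.indep_vars_def, THEN conjunct1, rule_format]
  have D: "D \<in> measurable M ?SS"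
    unfolding D_def sample_space_def by (rule measurable_restrict) (rule rv)
  define P where "P = distr M ?O (\<lambda>w. (X 1 w, y 1 w))"
  have n1: "1 \<in> {1..n}" using n by simp
  interpret P: prob_space P unfolding P_def by (rule M.prob_space_distr[OF rv[OF n1]])
  have XU [measurable]: "X 1 \<in> measurable M (borel_vec d)" "U 1 \<in> borel_measurable M"
    using U by (auto simp: indep_pair_def)
  \<comment> \<open>The law of one pair as the image of a product measure: the covariate becomes a
    separate factor on which a rotation can act.\<close>
  have P_eq: "P = distr (distr M (borel_vec d) (X 1) \<Otimes>\<^sub>M distr M borel (U 1)) ?O (\<lambda>(x, u). (x, F (\<beta> \<bullet> x) u))"
    unfolding distr_indep_pair[OF prob U, symmetric] P_def
    by (subst distr_distr[OF measurable_response[OF \<beta> F] measurable_Pair[OF XU]])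
       (auto simp del: One_nat_def simp: y comp_def intro!: distr_cong)
  have law: "distr M ?SS D = (\<Pi>\<^sub>M i\<in>{1..n}. P)"
  proof -
    have "distr M ?SS D = (\<Pi>\<^sub>M i\<in>{1..n}. distr M ?O (\<lambda>w. (X i w, y i w)))"
      unfolding D_def sample_space_def
      using M.indep_vars_iff_distr_eq_PiM'[of "{1..n}" "\<lambda>i w. (X i w, y i w)" "\<lambda>_. ?O"] rv indep n by auto
    also have "\<dots> = (\<Pi>\<^sub>M i\<in>{1..n}. P)"
      unfolding P_def by (intro PiM_cong refl ident)
    finally show ?thesis .
  qed
  have setsP: "sets P = sets ?O" by (simp add: P_def)
  have setsPD: "sets (\<Pi>\<^sub>M i\<in>{1..n}. P) = sets ?SS"
    unfolding sample_space_def by (intro sets_PiM_cong) (auto simp: setsP)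
  define \<psi> where "\<psi> s = W.residual (bbar s)" for s
  have \<psi>: "\<psi> \<in> measurable ?SS (borel_vec d)"
    unfolding \<psi>_def by (rule measurable_compose[OF bbar W.measurable_residual])
  define N where "N = distr M (borel_vec d) (\<lambda>w. \<psi> (D w))"
  have \<psi>D: "(\<lambda>w. \<psi> (D w)) \<in> measurable M (borel_vec d)" by (rule measurable_compose[OF D \<psi>])
  have N_eq: "N = distr (\<Pi>\<^sub>M i\<in>{1..n}. P) (borel_vec d) \<psi>"
    unfolding N_def law[symmetric] by (subst distr_distr[OF \<psi> D]) (simp add: comp_def)
  have bc: "bbar s \<in> carrier_vec d" if "s \<in> space ?SS" for s
    using measurable_space[OF bbar that] by simp
  have spaceO: "space ?O = carrier_vec d \<times> Y"
    by (simp add: obs_space_def space_pair_measure space_restrict_space)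
  have invariant: "distr N (borel_vec d) (reflect w) = N" if w: "w \<in> carrier_vec d" "w \<bullet> W.\<theta> = 0" for w
  proof -
    define k where "k = (\<lambda>(x, r :: real). (W.rot_X w x, r))"
    define K where "K s = (\<lambda>i\<in>{1..n}. k (s i))" for s :: sample
    have k: "k \<in> measurable ?O ?O"
      unfolding obs_space_def k_def split_beta
      by (intro measurable_Pair measurable_compose[OF measurable_fst] W.measurable_rot_X w measurable_snd)
    have kP: "distr P ?O k = P"
      unfolding P_eq k_def
    proof (rule pair_law_invariant[OF _ _ _ _ _ _ \<beta> _ F])
      show "prob_space (distr M (borel_vec d) (X 1))" "prob_space (distr M borel (U 1))"
        by (rule M.prob_space_distr, measurable)+
      show "W.rot_X w \<in> measurable (borel_vec d) (borel_vec d)" by (rule W.measurable_rot_X[OF w(1)])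
      show "distr (distr M (borel_vec d) (X 1)) (borel_vec d) (W.rot_X w) = distr M (borel_vec d) (X 1)"
        unfolding XA by (rule W.normal_law_rot_X[OF w(1)])
      show "\<beta> \<bullet> W.rot_X w x = \<beta> \<bullet> x" if "x \<in> carrier_vec d" for x
        using W.rot_b_adjoint[OF w(1) \<beta> that] W.rot_b_\<beta>[OF w] by simp
    qed simp_all
    have K: "K \<in> measurable ?SS ?SS"
      unfolding K_def sample_space_def
      by (intro measurable_restrict measurable_compose[OF _ k] measurable_component_singleton)
    have KP: "distr (\<Pi>\<^sub>M i\<in>{1..n}. P) ?SS K = (\<Pi>\<^sub>M i\<in>{1..n}. P)"
      unfolding K_def[abs_def] sample_space_def
      by (rule sample_law_invariant[OF _ P.prob_space_axioms setsP k kP]) simp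
    have K': "K \<in> measurable (\<Pi>\<^sub>M i\<in>{1..n}. P) ?SS"
      unfolding measurable_cong_sets[OF setsPD refl] by (rule K)
    have \<psi>': "\<psi> \<in> measurable (\<Pi>\<^sub>M i\<in>{1..n}. P) (borel_vec d)"
      unfolding measurable_cong_sets[OF setsPD refl] by (rule \<psi>)
    have spP: "space (\<Pi>\<^sub>M i\<in>{1..n}. P) = space ?SS" by (rule sets_eq_imp_space_eq[OF setsPD])
    have am: "AE s in (\<Pi>\<^sub>M i\<in>{1..n}. P).
        {b. is_arg_min (total_loss l n s) (\<lambda>b. b \<in> carrier_vec d) b} = {bbar s}"
      using argmin unfolding law .
    \<comment> \<open>The exceptional null set pulls back to a null set because \<open>K\<close>
      preserves the law of the sample.\<close>
    have am': "AE s in (\<Pi>\<^sub>M i\<in>{1..n}. P).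
        {b. is_arg_min (total_loss l n (K s)) (\<lambda>b. b \<in> carrier_vec d) b} = {bbar (K s)}"
      by (rule AE_distrD[OF K']) (use am in \<open>unfold KP\<close>)
    have AE: "AE s in (\<Pi>\<^sub>M i\<in>{1..n}. P). reflect w (\<psi> s) = \<psi> (K s)"
      using am am' AE_space
    proof eventually_elim
      case (elim s)
      have s: "s \<in> space ?SS" using elim(3) unfolding spP .
      \<comment> \<open>The loss of the rotated sample is the original loss composed with the
        involution \<open>W.rot_b w\<close>, and both have unique minimizers here.\<close>
      have "bbar (K s) = W.rot_b w (bbar s)"
      proof (rule is_arg_min_image[OF _ _ _ elim(1,2)])
        fix b :: "real vec" assume b: "b \<in> carrier_vec d"
        have "b \<bullet> fst (K s i) = W.rot_b w b \<bullet> fst (s i)" "snd (K s i) = snd (s i)" if i: "i \<in> {1..n}" for i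
        proof -
          have "s i \<in> space ?O"
            using s i by (auto simp: sample_space_def space_PiM)
          then have "fst (s i) \<in> carrier_vec d" by (auto simp: spaceO)
          then show "b \<bullet> fst (K s i) = W.rot_b w b \<bullet> fst (s i)" "snd (K s i) = snd (s i)"
            using W.rot_b_adjoint[OF w(1) b] i by (auto simp: K_def k_def split_beta)
        qed
        then show "total_loss l n (K s) b = total_loss l n s (W.rot_b w b)"
          unfolding total_loss_def by (intro sum.cong) auto
      qed (use w in \<open>auto intro: W.rot_b_carrier W.rot_b_involution\<close>)
      then show ?case
        using W.residual_rot_b[OF w bc[OF s]] by (simp add: \<psi>_def)
    qed
    have "distr N (borel_vec d) (reflect w) = distr (\<Pi>\<^sub>M i\<in>{1..n}. P) (borel_vec d) (\<lambda>s. reflect w (\<psi> s))"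
      unfolding N_eq by (subst distr_distr[OF measurable_reflect[OF w(1)] \<psi>']) (simp add: comp_def)
    also have "\<dots> = distr (\<Pi>\<^sub>M i\<in>{1..n}. P) (borel_vec d) (\<lambda>s. \<psi> (K s))"
      using AE by (intro distr_cong_AE measurable_compose[OF \<psi>' measurable_reflect[OF w(1)]]
          measurable_compose[OF K' \<psi>]) auto
    also have "\<dots> = distr (distr (\<Pi>\<^sub>M i\<in>{1..n}. P) ?SS K) (borel_vec d) \<psi>"
      by (subst distr_distr[OF \<psi> K']) (simp add: comp_def)
    finally show ?thesis unfolding KP N_eq .
  qed
  have Dc: "bbar (D w) \<in> carrier_vec d" if "w \<in> space M" for w
    using bc[OF measurable_space[OF D that]] .
  have orth: "AE v in N. W.\<theta> \<bullet> v = 0"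
  proof -
    have [measurable]: "(\<lambda>v. W.\<theta> \<bullet> v) \<in> borel_measurable (borel_vec d)"
      by (intro borel_measurable_scalar_prod[where d=d] borel_vec_measurable_const W.\<theta> measurable_borel_vec_id)
    have "{v \<in> space (borel_vec d). W.\<theta> \<bullet> v = 0} \<in> sets (borel_vec d)" by measurable
    then show ?thesis
      unfolding N_def by (subst AE_distr_iff[OF \<psi>D]) (auto intro!: AE_I2 W.residual_\<theta> simp: \<psi>_def Dc)
  qed
  interpret N: prob_space N unfolding N_def by (rule M.prob_space_distr[OF \<psi>D])
  interpret L: axial_law N d W.\<theta>
    by unfold_locales (use W.\<theta> W.\<theta>_unit orth invariant in \<open>auto simp: N_def\<close>)
  define u where "u = W.direction j"
  have u: "u \<in> carrier_vec d" "u \<bullet> u = 1" "u \<bullet> W.\<theta> = tau_coef S j * \<beta> $ j"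
    using W.direction_carrier[OF j] W.direction_unit[OF j] W.direction_\<theta>[OF j] by (simp_all add: u_def AS)
  \<comment> \<open>In general \<open>u\<close> is not orthogonal to the axis, but the residual sees
    only its projection, which has squared length
    \<open>1 - (u \<bullet> W.\<theta>)\<^sup>2\<close>.\<close>
  define b where "b = sqrt (real d) \<cdot>\<^sub>v L.perp u"
  have pu: "L.perp u \<in> carrier_vec d" by (rule L.perp_carrier[OF u(1)])
  have b: "b \<in> carrier_vec d" "b \<bullet> W.\<theta> = 0"
    using pu L.perp_axis[OF u(1)] W.\<theta> by (simp_all add: b_def)
  have "b \<bullet> b = sqrt (real d) * (sqrt (real d) * (L.perp u \<bullet> L.perp u))"
    using pu by (simp add: b_def)
  also have "\<dots> = real d * (1 - (tau_coef S j * \<beta> $ j)\<^sup>2)"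
    using L.perp_norm[OF u(1)] u comm_scalar_prod[OF W.\<theta> u(1)] by simp
  also have "\<dots> = real d - x\<^sup>2"
    by (simp add: x_def power_mult_distrib algebra_simps)
  finally have bb: "b \<bullet> b = real d - x\<^sup>2" .
  then have b0: "b \<noteq> 0\<^sub>v d" using x by auto
  \<comment> \<open>The underlying identity is pointwise, even where the residual vanishes: there
    both sides are \<open>0\<close> by the convention for division.\<close>
  have T: "distr M borel (\<lambda>w. T_stat S \<beta> (bbar (D w)) j) = distr N borel (vec_component b)"
  proof -
    have "vec_component b \<in> borel_measurable (borel_vec d)"
      using L.component_measurable[OF b(1)] by (simp add: L.measurable_N)
    then have "distr N borel (vec_component b) = distr M borel (\<lambda>w. vec_component b (\<psi> (D w)))"
      unfolding N_def by (subst distr_distr[OF _ \<psi>D]) (auto simp: comp_def)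
    also have "\<dots> = distr M borel (\<lambda>w. T_stat S \<beta> (bbar (D w)) j)"
    proof (rule distr_cong[OF refl refl])
      fix w assume "w \<in> space M"
      note c = Dc[OF this]
      have r: "W.residual (bbar (D w)) \<in> carrier_vec d" by (rule W.residual_carrier[OF c])
      have "L.perp u \<bullet> W.residual (bbar (D w)) = u \<bullet> W.residual (bbar (D w))"
        using u(1) W.\<theta> r W.residual_\<theta>[OF c] by (simp add: L.perp_def minus_scalar_prod_distrib[of _ d])
      then show "vec_component b (\<psi> (D w)) = T_stat S \<beta> (bbar (D w)) j"
        using W.T_stat_eq[OF j c] vec_component_smult[OF pu r]
        by (simp add: AS b_def \<psi>_def u_def vec_component_def)
    qed
    finally show ?thesis by simp
  qed
  \<comment> \<open>\<open>sigma_coef\<close> is the length of the residual, so the atom at zero is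
    the event of a vanishing scale.\<close>
  have Z: "N.prob {0\<^sub>v d} = measure M {w \<in> space M. sigma_coef S \<beta> (bbar (D w)) = 0}"
  proof -
    have "{v \<in> space (borel_vec d). vec_norm2 v = 0} \<in> sets (borel_vec d)"
      using measurable_vec_norm2[OF measurable_borel_vec_id[of d]] by measurable
    also have "{v \<in> space (borel_vec d). vec_norm2 v = 0} = {0\<^sub>v d}"
      using vec_norm2_eq_0[of _ d] by auto
    finally have "N.prob {0\<^sub>v d} = measure M ((\<lambda>w. \<psi> (D w)) -` {0\<^sub>v d} \<inter> space M)"
      unfolding N_def by (rule measure_distr[OF \<psi>D])
    also have "(\<lambda>w. \<psi> (D w)) -` {0\<^sub>v d} \<inter> space M = {w \<in> space M. sigma_coef S \<beta> (bbar (D w)) = 0}"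
      using W.sigma_coef_eq[OF Dc] vec_norm2_eq_0[OF W.residual_carrier[OF Dc]]
        vec_norm2_eq_0[OF zero_carrier_vec[of d]] by (auto simp: \<psi>_def AS)
    finally show ?thesis .
  qed
  have "vec_norm2 b = sqrt (real d - x\<^sup>2)" by (simp add: vec_norm2_def bb)
  then show ?thesis
    using L.char_component_bound[OF b b0 d, of t] by (simp add: T Z bb)
qed

section \<open>Passage to the limit\<close>

theorem theorem6:
  fixes M :: "nat \<Rightarrow> 'w measure"
    and p :: "nat \<Rightarrow> nat"
    and Sigma :: "nat \<Rightarrow> real mat"
    and \<beta> :: "nat \<Rightarrow> real vec"
    and X :: "nat \<Rightarrow> nat \<Rightarrow> 'w \<Rightarrow> real vec"
    and U y :: "nat \<Rightarrow> nat \<Rightarrow> 'w \<Rightarrow> real"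
    and F :: "real \<Rightarrow> real \<Rightarrow> real"
    and Y :: "real set"
    and l :: "real \<Rightarrow> real \<Rightarrow> real"
    and bbar :: "nat \<Rightarrow> sample \<Rightarrow> real vec"
    and j :: "nat \<Rightarrow> nat"
    and c\<^sub>\<Sigma> C \<kappa> :: real
  defines "D \<equiv> \<lambda>n w. \<lambda>i\<in>{1..n}. (X n i w, y n i w)"
  assumes prob: "\<And>n. prob_space (M n)"
    and Sigma_dim: "\<And>n. Sigma n \<in> carrier_mat (p n) (p n)"
    and beta_dim: "\<And>n. \<beta> n \<in> carrier_vec (p n)"
    and F_meas: "case_prod F \<in> measurable (borel \<Otimes>\<^sub>M borel) (restrict_space borel Y)"
    and X_normal: "\<And>n i. i \<in> {1..n} \<Longrightarrow>
      centered_normal_law (p n) (Sigma n) (distr (M n) (borel_vec (p n)) (X n i))"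
    and U_indep: "\<And>n i. i \<in> {1..n} \<Longrightarrow>
      indep_pair (M n) (borel_vec (p n)) (X n i) borel (U n i)"
    and y_eq: "\<And>n i w. i \<in> {1..n} \<Longrightarrow> w \<in> space (M n) \<Longrightarrow>
      y n i w = F (\<beta> n \<bullet> X n i w) (U n i w)"
    and indep: "\<And>n. prob_space.indep_vars (M n) (\<lambda>_. obs_space (p n) Y)
      (\<lambda>i w. (X n i w, y n i w)) {1..n}"
    and ident: "\<And>n i k. i \<in> {1..n} \<Longrightarrow> k \<in> {1..n} \<Longrightarrow>
      distr (M n) (obs_space (p n) Y) (\<lambda>w. (X n i w, y n i w)) =
      distr (M n) (obs_space (p n) Y) (\<lambda>w. (X n k w, y n k w))"
    and normalized: "\<And>n. \<beta> n \<bullet> (Sigma n *\<^sub>v \<beta> n) = 1"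
    and c_pos: "0 < inverse c\<^sub>\<Sigma>"
    and lambda_min: "\<And>n. inverse c\<^sub>\<Sigma> \<le> Min (spectrum (Sigma n))"
    and lambda_max: "\<And>n. Max (spectrum (Sigma n)) \<le> c\<^sub>\<Sigma>"
    and bbar_meas: "\<And>n. bbar n \<in> measurable (sample_space n (p n) Y) (borel_vec (p n))"
    and bbar_unique_argmin: "\<forall>\<^sub>F n in sequentially.
      AE s in distr (M n) (sample_space n (p n) Y) (D n).
        {b. is_arg_min (total_loss l n s) (\<lambda>b. b \<in> carrier_vec (p n)) b} = {bbar n s}"
    and C_pos: "0 < C"
    and bbar_bounded: "\<exists>r \<in> o(\<lambda>_. 1). \<forall>n.
      measure (M n) {w \<in> space (M n). vec_norm2 (bbar n (D n w)) < C} \<ge> 1 - r n"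
    and sigma_nonzero: "(\<lambda>n. measure (M n)
      {w \<in> space (M n). sigma_coef (Sigma n) (\<beta> n) (bbar n (D n w)) \<noteq> 0}) \<longlonglongrightarrow> 1"
    and j_coord: "\<And>n. j n < p n"
    and j_small: "(\<lambda>n. sqrt (real (p n)) * tau_coef (Sigma n) (j n) * \<beta> n $ j n) \<in> O(\<lambda>_. 1)"
    and p_at_top: "filterlim p at_top sequentially"
    and ratio: "(\<lambda>n. real (p n) / real n) \<longlonglongrightarrow> \<kappa>"
    and kappa: "0 < \<kappa>" "\<kappa> < 1"
  shows "weak_conv_m
    (\<lambda>n. distr (M n) borel (\<lambda>w. T_stat (Sigma n) (\<beta> n) (bbar n (D n w)) (j n)))
    std_normal_distribution"
proof (rule levy_continuity)
  have bD: "(\<lambda>w. bbar n (D n w)) \<in> measurable (M n) (borel_vec (p n))" for n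
  proof (rule measurable_compose[OF _ bbar_meas])
    show "D n \<in> measurable (M n) (sample_space n (p n) Y)"
      unfolding D_def sample_space_def using indep[of n, unfolded prob_space.indep_vars_def[OF prob]]
      by (intro measurable_restrict) blast
  qed
  show "real_distribution (distr (M n) borel (\<lambda>w. T_stat (Sigma n) (\<beta> n) (bbar n (D n w)) (j n)))" for n
    by (intro prob_space.real_distribution_distr prob measurable_T_stat[OF Sigma_dim beta_dim bD j_coord])
  show "real_distribution std_normal_distribution" by (rule real_dist_normal_dist)
  fix t :: real
  let ?x = "\<lambda>n. sqrt (real (p n)) * tau_coef (Sigma n) (j n) * \<beta> n $ j n"
  let ?\<sigma>0 = "\<lambda>n. measure (M n) {w \<in> space (M n). sigma_coef (Sigma n) (\<beta> n) (bbar n (D n w)) = 0}"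
  obtain c where c: "0 < c" "\<forall>\<^sub>F n in sequentially. \<bar>?x n\<bar> \<le> c"
    using j_small by (auto elim: landau_o.bigE)
  \<comment> \<open>The error factor with the offset \<open>?x n\<close> replaced by its bound
    \<open>c\<close>. Its numerator grows like \<open>sqrt (2 * x)\<close> and its denominator like
    \<open>x\<close>.\<close>
  define g where "g x = (c\<^sup>2 + sqrt (2 * x) + 1) / (sqrt (x - c\<^sup>2) * sqrt (x - 1))" for x :: real
  have "(g \<longlongrightarrow> 0) at_top"
    unfolding g_def by real_asymp
  then have g: "(\<lambda>n. g (real (p n))) \<longlonglongrightarrow> 0"
    by (rule filterlim_compose) (rule filterlim_compose[OF filterlim_real_sequentially p_at_top])
  \<comment> \<open>On a vanishing scale the statistic takes the default value \<open>0\<close>;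
    \<open>sigma_nonzero\<close> makes the mass of this event disappear in the limit.\<close>
  have \<sigma>0: "?\<sigma>0 \<longlonglongrightarrow> 0"
  proof -
    have "?\<sigma>0 n = 1 - measure (M n) {w \<in> space (M n). sigma_coef (Sigma n) (\<beta> n) (bbar n (D n w)) \<noteq> 0}" for n
    proof -
      interpret prob_space "M n" by (rule prob)
      note [measurable] = measurable_sigma_coef[OF Sigma_dim beta_dim bD]
      show ?thesis by (subst prob_neg[symmetric]) auto
    qed
    then show ?thesis
      using tendsto_diff[OF tendsto_const[of 1] sigma_nonzero] by simp
  qed
  \<comment> \<open>The threshold secures both dimension conditions of
    \<open>char_T_stat_bound\<close>; the condition that \<open>n\<close> is at least
    \<open>1\<close>, added below, provides the observation with index \<open>1\<close>.\<close>
  have "\<forall>\<^sub>F n in sequentially. real (p n) > max 2 (c\<^sup>2)"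
    using filterlim_compose[OF filterlim_real_sequentially p_at_top] unfolding filterlim_at_top_dense by blast
  then have "\<forall>\<^sub>F n in sequentially.
      cmod (char (distr (M n) borel (\<lambda>w. T_stat (Sigma n) (\<beta> n) (bbar n (D n w)) (j n))) t
        - char std_normal_distribution t) \<le> ?\<sigma>0 n + \<bar>t\<bar> * g (real (p n))"
    using bbar_unique_argmin c(2) eventually_ge_at_top[of 1]
  proof eventually_elim
    case (elim n)
    have xc: "(?x n)\<^sup>2 \<le> c\<^sup>2" using elim(3) by (simp add: abs_le_square_iff[symmetric])
    have n1: "1 \<in> {1..n}" using elim(4) by simp
    have spec: "0 < Min (spectrum (Sigma n))" using c_pos lambda_min[of n] by linarith
    have "cmod (char (distr (M n) borel (\<lambda>w. T_stat (Sigma n) (\<beta> n) (bbar n (D n w)) (j n))) t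
        - char std_normal_distribution t)
      \<le> ?\<sigma>0 n + \<bar>t\<bar> * (((?x n)\<^sup>2 + sqrt (2 * real (p n)) + 1) / (sqrt (real (p n) - (?x n)\<^sup>2) * sqrt (real (p n) - 1)))"
      unfolding D_def
    proof (rule char_T_stat_bound[where n = n and d = "p n" and j = "j n" and S = "Sigma n" and \<beta> = "\<beta> n"
          and M = "M n" and X = "X n" and U = "U n" and y = "y n" and F = F and Y = Y and bbar = "bbar n" and l = l])
      show "2 \<le> p n" "(?x n)\<^sup>2 < real (p n)"
        using elim(1) xc by auto
    qed (fact prob elim(4) Sigma_dim beta_dim F_meas X_normal[OF n1] U_indep[OF n1] indep normalized spec
        bbar_meas elim(2)[unfolded D_def] j_coord
        | (rule y_eq[OF n1], assumption) | (rule ident[OF _ n1], assumption))+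
    also have "\<dots> \<le> ?\<sigma>0 n + \<bar>t\<bar> * g (real (p n))"
      unfolding g_def using elim(1) xc
      by (intro add_left_mono mult_left_mono frac_le mult_right_mono) auto
    finally show ?case .
  qed
  moreover have "(\<lambda>n. ?\<sigma>0 n + \<bar>t\<bar> * g (real (p n))) \<longlonglongrightarrow> 0"
    using tendsto_add[OF \<sigma>0 tendsto_mult_right_zero[OF g, of "\<bar>t\<bar>"]] by simp
  ultimately have "(\<lambda>n. char (distr (M n) borel (\<lambda>w. T_stat (Sigma n) (\<beta> n) (bbar n (D n w)) (j n))) t
      - char std_normal_distribution t) \<longlonglongrightarrow> 0"
    by (rule Lim_null_comparison)
  then show "(\<lambda>n. char (distr (M n) borel (\<lambda>w. T_stat (Sigma n) (\<beta> n) (bbar n (D n w)) (j n))) t)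
      \<longlonglongrightarrow> char std_normal_distribution t"
    by (rule LIM_zero_cancel)
qed

end
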